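(* Let $n\geq 3$ be an integer and let $p$ be an odd prime number. Let $F$ be a $p$-rigid field which contains a primitive $p$-th root of unity. Then for any $\alpha_1,\ldots,\alpha_n\in H^1(G_F,\mathbb{F}_p)$, the $n$-fold Massey product $\langle\alpha_1,\ldots,\alpha_n\rangle$ contains $0$ whenever it is defined.
   Context: For $a\in F^\times$, $\chi_a\in H^1(G_F,\mathbb{F}_p)$ is the Kummer character of $a$. An element $a\in F^\times\setminus(F^\times)^p$ is $p$-rigid if for $b\in F^\times$, $\chi_a\cup\chi_b=0$ in $H^2(G_F,\mathbb{F}_p)$ implies $b\in a^i(F^\times)^p$ for some $i\geq0$; $F$ is $p$-rigid if every element of $F^\times\setminus(F^\times)^p$ is $p$-rigid. Massey products: for a profinite group $G$ with trivial module $\mathbb{F}_p$ and inhomogeneous continuous cochain complex $\mathcal{C}^\bullet(G,\mathbb{F}_p)$ (differential $\delta$, cup product $\cup$), a defining system for $\langle\alpha_1,\ldots,\alpha_n\rangle$ ($\alpha_i\in H^1(G,\mathbb{F}_p)$) is a family $(a_{ij})$, $1\leq i<j\leq n+1$, $(i,j)\neq(1,n+1)$, of $1$-cochains with $a_{i,i+1}$ representing $\alpha_i$ and $\delta a_{ij}=\sum_{l=i+1}^{j-1}a_{il}\cup a_{lj}$ for $i+1<j$; its value is the class of the $2$-cocycle $\sum_{k=2}^n a_{1k}\cup a_{k,n+1}$. The Massey product is the set of all such values, and is defined if some defining system exists. *)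

theory Defs
  imports "HOL-Algebra.Algebraic_Closure" "HOL-Computational_Algebra.Primes"
begin

text \<open>Setting: L is an algebraic closure of the field F, where F is given as a subfield K of L
  (carrier K, operations of L). The absolute Galois group G_F is realised as Aut(L/F),
  automorphisms of L fixing K pointwise (extended by the identity off carrier L, so that
  composition stays in the group). Elements of F_p are represented by integers modulo p.\<close>

definition gal :: "('b, 'c) ring_scheme \<Rightarrow> 'b set \<Rightarrow> ('b \<Rightarrow> 'b) set" where
  "gal L K = {\<sigma>. \<sigma> \<in> ring_iso L L \<and> (\<forall>x\<in>K. \<sigma> x = x) \<and> (\<forall>x. x \<notin> carrier L \<longrightarrow> \<sigma> x = x)}"

text \<open>Continuity of a 1-cochain G -> F_p (F_p discrete, Krull topology on G): locally constant,
  a basic neighbourhood of sigma being the automorphisms agreeing with sigma on a finite set.\<close>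
definition cont1 :: "('b, 'c) ring_scheme \<Rightarrow> 'b set \<Rightarrow> nat \<Rightarrow> (('b \<Rightarrow> 'b) \<Rightarrow> int) \<Rightarrow> bool" where
  "cont1 L K p c \<longleftrightarrow> (\<forall>\<sigma>\<in>gal L K. \<exists>S. finite S \<and> S \<subseteq> carrier L \<and>
      (\<forall>\<tau>\<in>gal L K. (\<forall>x\<in>S. \<tau> x = \<sigma> x) \<longrightarrow> c \<tau> mod int p = c \<sigma> mod int p))"

text \<open>Continuous 1-cocycles (trivial action): these are exactly the elements of H^1(G_F, F_p).\<close>
definition cocycle1 :: "('b, 'c) ring_scheme \<Rightarrow> 'b set \<Rightarrow> nat \<Rightarrow> (('b \<Rightarrow> 'b) \<Rightarrow> int) \<Rightarrow> bool" where
  "cocycle1 L K p c \<longleftrightarrow> cont1 L K p c \<and>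
     (\<forall>\<sigma>\<in>gal L K. \<forall>\<tau>\<in>gal L K. (c \<tau> - c (\<sigma> \<circ> \<tau>) + c \<sigma>) mod int p = 0)"

definition coboundary2 :: "('b, 'c) ring_scheme \<Rightarrow> 'b set \<Rightarrow> nat \<Rightarrow> (('b \<Rightarrow> 'b) \<Rightarrow> ('b \<Rightarrow> 'b) \<Rightarrow> int) \<Rightarrow> bool" where
  "coboundary2 L K p f \<longleftrightarrow> (\<exists>c. cont1 L K p c \<and>
     (\<forall>\<sigma>\<in>gal L K. \<forall>\<tau>\<in>gal L K. f \<sigma> \<tau> mod int p = (c \<tau> - c (\<sigma> \<circ> \<tau>) + c \<sigma>) mod int p))"

definition primitive_root :: "('b, 'c) ring_scheme \<Rightarrow> 'b set \<Rightarrow> nat \<Rightarrow> 'b \<Rightarrow> bool" where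
  "primitive_root L K p \<zeta> \<longleftrightarrow> \<zeta> \<in> K \<and> \<zeta> [^]\<^bsub>L\<^esub> p = \<one>\<^bsub>L\<^esub> \<and>
     (\<forall>k::nat. 0 < k \<and> k < p \<longrightarrow> \<zeta> [^]\<^bsub>L\<^esub> k \<noteq> \<one>\<^bsub>L\<^esub>)"

text \<open>chi is the Kummer character of b (w.r.t. the identification mu_p = F_p, zeta |-> 1):
  sigma(beta) = zeta^(chi sigma) * beta for a p-th root beta of b.\<close>
definition kummer_char :: "('b, 'c) ring_scheme \<Rightarrow> 'b set \<Rightarrow> nat \<Rightarrow> 'b \<Rightarrow> 'b \<Rightarrow> (('b \<Rightarrow> 'b) \<Rightarrow> int) \<Rightarrow> bool" where
  "kummer_char L K p \<zeta> b \<chi> \<longleftrightarrow> (\<exists>\<beta>\<in>carrier L. \<beta> [^]\<^bsub>L\<^esub> p = b \<and>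
     (\<forall>\<sigma>\<in>gal L K. \<sigma> \<beta> = (\<zeta> [^]\<^bsub>L\<^esub> nat (\<chi> \<sigma> mod int p)) \<otimes>\<^bsub>L\<^esub> \<beta>))"

definition pth_power :: "('b, 'c) ring_scheme \<Rightarrow> 'b set \<Rightarrow> nat \<Rightarrow> 'b \<Rightarrow> bool" where
  "pth_power L K p b \<longleftrightarrow> (\<exists>c\<in>K. b = c [^]\<^bsub>L\<^esub> p)"

definition p_rigid_elem :: "('b, 'c) ring_scheme \<Rightarrow> 'b set \<Rightarrow> nat \<Rightarrow> 'b \<Rightarrow> 'b \<Rightarrow> bool" where
  "p_rigid_elem L K p \<zeta> a \<longleftrightarrow>
     (\<forall>b\<in>K - {\<zero>\<^bsub>L\<^esub>}. \<forall>\<chi>a \<chi>b. kummer_char L K p \<zeta> a \<chi>a \<and> kummer_char L K p \<zeta> b \<chi>b \<and>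
        coboundary2 L K p (\<lambda>\<sigma> \<tau>. \<chi>a \<sigma> * \<chi>b \<tau>) \<longrightarrow>
        (\<exists>i::nat. \<exists>c\<in>K - {\<zero>\<^bsub>L\<^esub>}. b = (a [^]\<^bsub>L\<^esub> i) \<otimes>\<^bsub>L\<^esub> (c [^]\<^bsub>L\<^esub> p)))"

definition p_rigid :: "('b, 'c) ring_scheme \<Rightarrow> 'b set \<Rightarrow> nat \<Rightarrow> 'b \<Rightarrow> bool" where
  "p_rigid L K p \<zeta> \<longleftrightarrow>
     (\<forall>a\<in>K - {\<zero>\<^bsub>L\<^esub>}. \<not> pth_power L K p a \<longrightarrow> p_rigid_elem L K p \<zeta> a)"

definition defining_system :: "('b, 'c) ring_scheme \<Rightarrow> 'b set \<Rightarrow> nat \<Rightarrow> nat \<Rightarrow>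
    (nat \<Rightarrow> ('b \<Rightarrow> 'b) \<Rightarrow> int) \<Rightarrow> (nat \<Rightarrow> nat \<Rightarrow> ('b \<Rightarrow> 'b) \<Rightarrow> int) \<Rightarrow> bool" where
  "defining_system L K p n \<alpha> a \<longleftrightarrow>
     (\<forall>i j. 1 \<le> i \<and> i < j \<and> j \<le> n + 1 \<and> (i, j) \<noteq> (1, n + 1) \<longrightarrow> cont1 L K p (a i j)) \<and>
     (\<forall>i. 1 \<le> i \<and> i \<le> n \<longrightarrow> (\<forall>\<sigma>\<in>gal L K. a i (i + 1) \<sigma> mod int p = \<alpha> i \<sigma> mod int p)) \<and>
     (\<forall>i j. 1 \<le> i \<and> i + 1 < j \<and> j \<le> n + 1 \<and> (i, j) \<noteq> (1, n + 1) \<longrightarrow>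
        (\<forall>\<sigma>\<in>gal L K. \<forall>\<tau>\<in>gal L K.
           (a i j \<tau> - a i j (\<sigma> \<circ> \<tau>) + a i j \<sigma>) mod int p =
           (\<Sum>l\<in>{i + 1..j - 1}. a i l \<sigma> * a l j \<tau>) mod int p))"

definition massey_value :: "nat \<Rightarrow> (nat \<Rightarrow> nat \<Rightarrow> ('b \<Rightarrow> 'b) \<Rightarrow> int) \<Rightarrow> ('b \<Rightarrow> 'b) \<Rightarrow> ('b \<Rightarrow> 'b) \<Rightarrow> int" where
  "massey_value n a \<sigma> \<tau> = (\<Sum>k\<in>{2..n}. a 1 k \<sigma> * a k (n + 1) \<tau>)"

definition massey_defined :: "('b, 'c) ring_scheme \<Rightarrow> 'b set \<Rightarrow> nat \<Rightarrow> nat \<Rightarrow> (nat \<Rightarrow> ('b \<Rightarrow> 'b) \<Rightarrow> int) \<Rightarrow> bool" where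
  "massey_defined L K p n \<alpha> \<longleftrightarrow> (\<exists>a. defining_system L K p n \<alpha> a)"

definition massey_contains_zero :: "('b, 'c) ring_scheme \<Rightarrow> 'b set \<Rightarrow> nat \<Rightarrow> nat \<Rightarrow> (nat \<Rightarrow> ('b \<Rightarrow> 'b) \<Rightarrow> int) \<Rightarrow> bool" where
  "massey_contains_zero L K p n \<alpha> \<longleftrightarrow>
     (\<exists>a. defining_system L K p n \<alpha> a \<and> coboundary2 L K p (massey_value n a))"

end

theory Submission
  imports Defs "HOL-Computational_Algebra.Formal_Power_Series"
begin

text \<open>
  By Kummer theory every character \<open>G_F \<rightarrow> F_p\<close> is the Kummer character of some \<open>b\<close> in \<open>F\<close>: a Lagrange
  resolvent \<open>\<beta>\<close> satisfies \<open>\<phi> \<beta> = \<zeta>^(\<alpha> \<phi>) \<beta>\<close>, so \<open>\<beta>^p\<close> is fixed by \<open>G_F\<close>; as the fixed field of \<open>G_F\<close>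
  may be a purely inseparable extension of \<open>F\<close>, one passes to a power of \<open>\<beta>\<close> prime to \<open>p\<close>.

  If the Massey product is defined, all \<open>\<alpha> i \<union> \<alpha> (i + 1)\<close> vanish, and rigidity makes \<open>\<alpha> (i + 1)\<close> a
  multiple of \<open>\<alpha> i\<close> unless \<open>\<alpha> i = 0\<close>. It therefore suffices to lift \<open>(\<alpha>, \<dots>, \<alpha>)\<close>, for a single Kummer
  character \<open>\<alpha>\<close>, to a homomorphism into unitriangular matrices; scaling the entries by products of the
  multipliers handles a block of proportional characters, and zero multipliers separate the blocks.
  The lift exists over every field containing \<open>\<zeta>\<close>: choose a root \<open>\<xi>\<close> of unity of large order \<open>p^N\<close> and
  \<open>b\<close> with \<open>b^(p^(N-1)) = \<beta>\<close>. Then \<open>\<phi> b = \<xi>^v b\<close> and \<open>\<phi> \<xi> = \<xi>^u\<close>, where \<open>u\<close> is 1 modulo \<open>p\<close>, and the affine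
  map \<open>x \<mapsto> u x + v\<close> acts on \<open>F_p[X]/(X^(n+1))\<close> by \<open>f \<mapsto> (1 + X)^v f((1 + X)^u - 1)\<close>. For odd \<open>p\<close> this is
  unitriangular with \<open>v\<close>, hence \<open>\<alpha>\<close>, next to the diagonal.
\<close>

section \<open>Extension of embeddings\<close>

context algebraic_closure
begin

text \<open>The domain is only asked to be a subring: by \<open>subring_imp_subfield\<close> every
  ring between \<open>K\<close> and \<open>L\<close> is a field, because \<open>L\<close> is
  algebraic over \<open>K\<close>.\<close>

definition embedding :: "'a set \<Rightarrow> ('a \<Rightarrow> 'a) \<Rightarrow> bool" where
  "embedding E f \<longleftrightarrow> subring E L \<and> K \<subseteq> E \<and> f \<in> ring_hom (L\<lparr>carrier := E\<rparr>) L \<and> (\<forall>k\<in>K. f k = k)"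

text \<open>For nonzero \<open>x\<close> in \<open>E\<close> the ring \<open>K[x]\<close> is already
  a field, as \<open>x\<close> is algebraic over \<open>K\<close>, and it lies inside
  \<open>E\<close>; so it supplies \<open>inv x\<close>.\<close>

lemma subring_imp_subfield:
  assumes "subring E L" "K \<subseteq> E"
  shows "subfield E L"
proof (rule subfieldI'[OF assms(1)])
  fix x assume x: "x \<in> E - {\<zero>}"
  then have xc: "x \<in> carrier L" using subringE(1)[OF assms(1)] by auto
  have "subfield (simple_extension K x) L"
    using simple_extension_is_subfield[OF subfield_axioms xc] algebraic_extension[OF xc] by simp
  then have "inv x \<in> simple_extension K x"
    using subfield_m_inv(1) simple_extension_mem[OF subfieldE(1)[OF subfield_axioms] xc] x by blast
  then show "inv x \<in> E"
    using simple_extension_subring_incl[OF assms] x by blast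
qed

lemma eval_root_exists:
  assumes "P \<in> carrier (poly_ring L)" "degree P > 0"
  shows "\<exists>w\<in>carrier L. eval P w = \<zero>"
proof -
  have "size (roots P) > 0"
    using roots_over_carrier[OF assms(1)] assms(2) unfolding splitted_def by simp
  then obtain w where "w \<in># roots P" by (metis size_eq_0_iff_empty less_irrefl multiset_nonemptyE)
  then show ?thesis using roots_mem_iff_is_root[OF assms(1)] unfolding is_root_def by blast
qed

text \<open>\<open>E[z]\<close> is the quotient of \<open>E[X]\<close> by \<open>Irr E z\<close>.
  Applying \<open>f\<close> to the coefficients and evaluating at \<open>w\<close> kills every
  multiple of \<open>Irr E z\<close>, so sending q(z) to (f q)(w) is well defined.\<close>

lemma embedding_extend:
  assumes emb: "embedding E f" and z: "z \<in> carrier L" and w: "w \<in> carrier L"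
    and root: "eval (map f (Irr E z)) w = \<zero>"
  obtains E' f' where "embedding E' f'" "E \<subseteq> E'" "\<And>a. a \<in> E \<Longrightarrow> f' a = f a" "z \<in> E'" "f' z = w"
proof -
  have E: "subring E L" "K \<subseteq> E" and fh: "f \<in> ring_hom (L\<lparr>carrier := E\<rparr>) L" and fK: "\<And>k. k \<in> K \<Longrightarrow> f k = k"
    using emb unfolding embedding_def by auto
  note Ef = subring_imp_subfield[OF E]
  have Ec: "E \<subseteq> carrier L" using subringE(1)[OF E(1)] .
  have alg: "(algebraic over E) z" using algebraic_mono[OF E(2) algebraic_extension[OF z]] .
  interpret H: ring_hom_ring "L\<lparr>carrier := E\<rparr>" L f
    using fh subring_is_ring[OF E(1)] ring_axioms by (simp add: ring_hom_ringI2)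
  have fc: "a \<in> E \<Longrightarrow> f a \<in> carrier L" for a using ring_hom_memE(1)[OF fh] by simp
  have setE: "set q \<subseteq> E" if "q \<in> carrier (E[X])" for q
    using that polynomial_incl unfolding univ_poly_carrier[symmetric] by blast
  have setf: "set (map f q) \<subseteq> carrier L" if "q \<in> carrier (E[X])" for q
    using setE[OF that] fc by auto
  \<comment> \<open>On coefficient lists \<open>map f\<close> commutes with multiplication only up
    to leading zeros, which \<open>eval\<close> does not see.\<close>
  have mult_eval: "eval (map f (p \<otimes>\<^bsub>E[X]\<^esub> q)) w = eval (map f p) w \<otimes> eval (map f q) w"
    if p: "p \<in> carrier (E[X])" and q: "q \<in> carrier (E[X])" for p q
  proof -
    have "normalize (map f (poly_mult p q)) = poly_mult (map f p) (map f q)"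
      using H.poly_mult_hom'[of p q] setE[OF p] setE[OF q] by (simp add: E(1))
    moreover have "p \<otimes>\<^bsub>E[X]\<^esub> q \<in> carrier (E[X])"
      using monoid.m_closed[OF univ_poly_is_monoid[OF E(1)] p q] .
    ultimately show ?thesis
      using eval_normalize[of "map f (poly_mult p q)" w] eval_poly_mult[OF setf[OF p] setf[OF q] w]
        setf[of "p \<otimes>\<^bsub>E[X]\<^esub> q"] w by (simp add: univ_poly_mult)
  qed
  have add_eval: "eval (map f (p \<oplus>\<^bsub>E[X]\<^esub> q)) w = eval (map f p) w \<oplus> eval (map f q) w"
    if p: "p \<in> carrier (E[X])" and q: "q \<in> carrier (E[X])" for p q
  proof -
    have "normalize (map f (poly_add p q)) = poly_add (map f p) (map f q)"
      using H.poly_add_hom'[of p q] setE[OF p] setE[OF q] by (simp add: E(1))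
    moreover have "p \<oplus>\<^bsub>E[X]\<^esub> q \<in> carrier (E[X])"
      using ring.ring_simprules(1)[OF univ_poly_is_ring[OF E(1)] p q] .
    ultimately show ?thesis
      using eval_normalize[of "map f (poly_add p q)" w] eval_poly_add[OF setf[OF p] setf[OF q] w]
        setf[of "p \<oplus>\<^bsub>E[X]\<^esub> q"] w by (simp add: univ_poly_add)
  qed
  interpret Z: ring_hom_ring "E[X]" L "\<lambda>p. eval p z" using eval_ring_hom[OF E(1) z] .
  define g where "g q = eval (map f q) w" for q
  have g_hom: "g \<in> ring_hom (E[X]) L"
  proof (rule ring_hom_memI)
    show "g \<one>\<^bsub>E[X]\<^esub> = \<one>" unfolding g_def univ_poly_one using H.hom_one w by simp
    show "g q \<in> carrier L" if "q \<in> carrier (E[X])" for q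
      unfolding g_def using eval_in_carrier[OF setf[OF that] w] .
  qed (auto simp: g_def mult_eval add_eval)
  interpret G: ring_hom_ring "E[X]" L g
    using g_hom by (simp add: ring_hom_ringI2 Z.R.ring_axioms ring_axioms)
  have kill: "g q = \<zero>" if q: "q \<in> carrier (E[X])" and 0: "eval q z = \<zero>" for q
  proof -
    have I: "Irr E z \<in> carrier (E[X])" using IrrE(1)[OF Ef z alg] .
    have "Irr E z pdivides q" using Irr_minimal[OF Ef z alg q 0] .
    then have "Irr E z divides\<^bsub>E[X]\<^esub> q" using pdivides_iff_shell[OF Ef I q] by simp
    then obtain r where r: "r \<in> carrier (E[X])" "q = Irr E z \<otimes>\<^bsub>E[X]\<^esub> r" unfolding factor_def by blast
    then show ?thesis using mult_eval[OF I r(1)] root eval_in_carrier[OF setf[OF r(1)] w] by (simp add: g_def)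
  qed
  have wd: "g p = g q" if p: "p \<in> carrier (E[X])" and q: "q \<in> carrier (E[X])" and e: "eval p z = eval q z" for p q
  proof -
    have "eval (p \<ominus>\<^bsub>E[X]\<^esub> q) z = \<zero>" using p q e by (simp add: a_minus_def r_neg)
    then have "g (p \<ominus>\<^bsub>E[X]\<^esub> q) = \<zero>" using kill p q by simp
    then have "g p \<ominus> g q = \<zero>" using p q by (simp add: a_minus_def)
    then show ?thesis using p q by simp
  qed
  define E' where "E' = (\<lambda>p. eval p z) ` carrier (E[X])"
  \<comment> \<open>\<open>SOME\<close> picks any polynomial representing \<open>a\<close>; by
    \<open>wd\<close> the value does not depend on the choice.\<close>
  define f' where "f' a = g (SOME p. p \<in> carrier (E[X]) \<and> eval p z = a)" for a
  have f': "f' (eval p z) = g p" if "p \<in> carrier (E[X])" for p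
    unfolding f'_def by (rule someI2[of _ p]) (use that in simp, rule wd, use that in simp_all)
  have E'eq: "E' = simple_extension E z"
    unfolding E'_def using simple_extension_as_eval_img[OF Ec z] by simp
  have sub: "E \<subseteq> E'" unfolding E'eq using simple_extension_incl[OF Ec z] .
  \<comment> \<open>Zero is treated apart: it is represented by the empty list, since
    \<open>[a]\<close> is a polynomial only for nonzero \<open>a\<close>.\<close>
  have ext: "f' a = f a" if a: "a \<in> E" for a
  proof (cases "a = \<zero>")
    case True
    then show ?thesis using f'[of "[]"] H.hom_zero by (simp add: univ_poly_zero_closed g_def)
  next
    case False
    then have "[a] \<in> carrier (E[X])" using a by (simp add: univ_poly_carrier[symmetric] const_is_polynomial)
    then show ?thesis using f'[of "[a]"] a Ec fc[OF a] w z by (auto simp: g_def)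
  qed
  have "embedding E' f'"
    unfolding embedding_def
  proof (intro conjI ballI)
    show "subring E' L" unfolding E'eq using simple_extension_is_subring[OF E(1) z] .
    show "K \<subseteq> E'" using sub E(2) by blast
    show "f' k = k" if "k \<in> K" for k using ext[of k] fK[OF that] E(2) that by auto
    show "f' \<in> ring_hom (L\<lparr>carrier := E'\<rparr>) L"
    proof (rule ring_hom_memI)
      fix a assume "a \<in> carrier (L\<lparr>carrier := E'\<rparr>)"
      then obtain p where p: "p \<in> carrier (E[X])" "a = eval p z" unfolding E'_def by auto
      then show "f' a \<in> carrier L" using f' G.hom_closed by simp
      fix b assume "b \<in> carrier (L\<lparr>carrier := E'\<rparr>)"
      then obtain q where q: "q \<in> carrier (E[X])" "b = eval q z" unfolding E'_def by auto
      have "f' (eval (p \<otimes>\<^bsub>E[X]\<^esub> q) z) = f' a \<otimes> f' b"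
        using p q by (simp add: f' del: Z.hom_mult)
      then show "f' (a \<otimes>\<^bsub>L\<lparr>carrier := E'\<rparr>\<^esub> b) = f' a \<otimes> f' b" using p q by simp
      have "f' (eval (p \<oplus>\<^bsub>E[X]\<^esub> q) z) = f' a \<oplus> f' b"
        using p q by (simp add: f' del: Z.hom_add)
      then show "f' (a \<oplus>\<^bsub>L\<lparr>carrier := E'\<rparr>\<^esub> b) = f' a \<oplus> f' b" using p q by simp
    next
      show "f' \<one>\<^bsub>L\<lparr>carrier := E'\<rparr>\<^esub> = \<one>" using ext[of \<one>] subringE(3)[OF E(1)] H.hom_one by simp
    qed
  qed
  moreover have X: "X \<in> carrier (E[X])" using var_closed(1)[OF E(1)] .
  moreover have "z \<in> E'" unfolding E'_def using eval_var[OF z] X by force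
  moreover have "f' z = w"
    using f'[OF X] eval_var[OF z] eval_var[OF w] H.hom_one H.hom_zero by (simp add: g_def var_def)
  ultimately show ?thesis using that sub ext by blast
qed

text \<open>Zorn's lemma: the domain of a maximal extension misses no \<open>z\<close>, because the
  minimal polynomial of \<open>z\<close>, transported by \<open>f\<close>, has a root in
  \<open>L\<close> to which \<open>z\<close> can be sent.\<close>

lemma embedding_extend_to_carrier:
  assumes emb0: "embedding E\<^sub>0 f\<^sub>0"
  obtains f where "embedding (carrier L) f" "\<And>a. a \<in> E\<^sub>0 \<Longrightarrow> f a = f\<^sub>0 a"
proof -
  \<comment> \<open>Partial maps are encoded by their graphs, so that extension becomes inclusion
    and a chain is bounded by its union.\<close>
  define graph where "graph E f = (\<lambda>a. (a, f a)) ` E" for E and f :: "'a \<Rightarrow> 'a"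
  define \<A> where "\<A> = {graph E f |E f. embedding E f \<and> graph E\<^sub>0 f\<^sub>0 \<subseteq> graph E f}"
  have ne: "\<A> \<noteq> {}" using emb0 unfolding \<A>_def by blast
  have union: "\<Union>\<C> \<in> \<A>" if C: "\<C> \<noteq> {}" "subset.chain \<A> \<C>" for \<C>
  proof -
    have CA: "\<C> \<subseteq> \<A>" and lin: "\<And>G H. G \<in> \<C> \<Longrightarrow> H \<in> \<C> \<Longrightarrow> G \<subseteq> H \<or> H \<subseteq> G"
      using C(2) unfolding subset.chain_def by auto
    define E where "E = fst ` \<Union>\<C>"
    define f where "f a = (SOME b. (a, b) \<in> \<Union>\<C>)" for a
    \<comment> \<open>Two elements of the union already lie in the domain of one member of the
      chain, so all ring laws can be checked there.\<close>
    have mem: "\<exists>E1 f1. graph E1 f1 \<in> \<C> \<and> embedding E1 f1 \<and> a \<in> E1 \<and> b \<in> E1"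
      if ab: "a \<in> E" "b \<in> E" for a b
    proof -
      obtain G H where "G \<in> \<C>" "a \<in> fst ` G" "H \<in> \<C>" "b \<in> fst ` H"
        using ab unfolding E_def by auto
      then obtain G where G: "G \<in> \<C>" "a \<in> fst ` G" "b \<in> fst ` G" using lin by (metis image_mono subsetD)
      then obtain E1 f1 where "G = graph E1 f1" "embedding E1 f1" using CA unfolding \<A>_def by blast
      then show ?thesis using G unfolding graph_def by (auto simp: image_image)
    qed
    have agree: "a \<in> E \<and> f a = f1 a" if G: "graph E1 f1 \<in> \<C>" "a \<in> E1" for E1 f1 a
    proof
      have U: "(a, f1 a) \<in> \<Union>\<C>" using G unfolding graph_def by blast
      then show "a \<in> E" unfolding E_def by force
      have "b = f1 a" if b: "(a, b) \<in> \<Union>\<C>" for b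
      proof -
        obtain H where H: "H \<in> \<C>" "(a, b) \<in> H" using b by blast
        obtain E2 f2 where "H = graph E2 f2" using H CA unfolding \<A>_def by blast
        then show ?thesis using lin[OF H(1) G(1)] H(2) G(2) unfolding graph_def by auto
      qed
      then show "f a = f1 a" unfolding f_def using someI[of "\<lambda>b. (a, b) \<in> \<Union>\<C>", OF U] by blast
    qed
    have sub: "E1 \<subseteq> E" if "graph E1 f1 \<in> \<C>" for E1 f1 using agree[OF that] by blast
    have UG: "\<Union>\<C> = graph E f"
    proof
      show "\<Union>\<C> \<subseteq> graph E f"
      proof
        fix x assume "x \<in> \<Union>\<C>"
        then obtain G where G: "G \<in> \<C>" "x \<in> G" by blast
        obtain E1 f1 where "G = graph E1 f1" using G(1) CA unfolding \<A>_def by blast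
        then show "x \<in> graph E f" using agree[of E1 f1] G unfolding graph_def by auto
      qed
      show "graph E f \<subseteq> \<Union>\<C>"
      proof
        fix x assume "x \<in> graph E f"
        then obtain a where a: "a \<in> E" "x = (a, f a)" unfolding graph_def by blast
        obtain E1 f1 where 1: "graph E1 f1 \<in> \<C>" "a \<in> E1" using mem[OF a(1) a(1)] by blast
        then show "x \<in> \<Union>\<C>" using agree[OF 1] a(2) unfolding graph_def by auto
      qed
    qed
    obtain G where G: "G \<in> \<C>" using C(1) by blast
    obtain E1 f1 where 1: "graph E1 f1 \<in> \<C>" "embedding E1 f1" "graph E\<^sub>0 f\<^sub>0 \<subseteq> graph E1 f1"
      using G CA unfolding \<A>_def by blast
    have "embedding E f"
      unfolding embedding_def
    proof (intro conjI ballI)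
      show KE: "K \<subseteq> E" using sub[OF 1(1)] 1(2) unfolding embedding_def by blast
      show "f k = k" if "k \<in> K" for k using agree[OF 1(1)] 1(2) that unfolding embedding_def by auto
      have cl: "a \<in> carrier L \<and> \<ominus> a \<in> E \<and> a \<oplus> b \<in> E \<and> a \<otimes> b \<in> E \<and> f a \<in> carrier L \<and>
         f (a \<oplus> b) = f a \<oplus> f b \<and> f (a \<otimes> b) = f a \<otimes> f b" if ab: "a \<in> E" "b \<in> E" for a b
      proof -
        obtain E2 f2 where 2: "graph E2 f2 \<in> \<C>" "embedding E2 f2" "a \<in> E2" "b \<in> E2" using mem[OF ab] by blast
        then have s: "subring E2 L" and h: "f2 \<in> ring_hom (L\<lparr>carrier := E2\<rparr>) L" unfolding embedding_def by auto
        have c: "\<ominus> a \<in> E2" "a \<oplus> b \<in> E2" "a \<otimes> b \<in> E2" "a \<in> carrier L"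
          using subringE[OF s] 2(3,4) by auto
        show ?thesis
          using c agree[OF 2(1)] 2(3,4) ring_hom_memE[OF h] by auto
      qed
      have "\<one> \<in> K" using subringE(3)[OF subfieldE(1)[OF subfield_axioms]] .
      moreover have "K \<subseteq> E1" "\<forall>k\<in>K. f1 k = k" using 1(2) unfolding embedding_def by auto
      ultimately have "\<one> \<in> E1" "f1 \<one> = \<one>" by auto
      then have one: "\<one> \<in> E" "f \<one> = \<one>" using agree[OF 1(1), of \<one>] by simp_all
      show "subring E L"
        by (rule subringI) (use cl one in blast)+
      show "f \<in> ring_hom (L\<lparr>carrier := E\<rparr>) L"
        by (rule ring_hom_memI) (use cl one in auto)
    qed
    moreover have "graph E\<^sub>0 f\<^sub>0 \<subseteq> graph E f" using 1 UG by blast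
    ultimately show ?thesis unfolding \<A>_def UG by blast
  qed
  obtain M where M: "M \<in> \<A>" and max: "\<And>N. N \<in> \<A> \<Longrightarrow> M \<subseteq> N \<Longrightarrow> N = M"
    using subset_Zorn_nonempty[OF ne union] by blast
  obtain E f where Ef: "M = graph E f" "embedding E f" "graph E\<^sub>0 f\<^sub>0 \<subseteq> graph E f"
    using M unfolding \<A>_def by blast
  have E: "subring E L" "K \<subseteq> E" and fh: "f \<in> ring_hom (L\<lparr>carrier := E\<rparr>) L"
    using Ef(2) unfolding embedding_def by auto
  have "z \<in> E" if z: "z \<in> carrier L" for z
  proof -
    note sE = subring_imp_subfield[OF E]
    have alg: "(algebraic over E) z" using algebraic_mono[OF E(2) algebraic_extension[OF z]] .
    note I = IrrE[OF sE z alg]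
    have deg: "degree (Irr E z) \<ge> 1" using pirreducible_degree[OF sE I(1,2)] .
    have "set (Irr E z) \<subseteq> E" using I(1) polynomial_incl unfolding univ_poly_carrier[symmetric] by blast
    moreover have "f \<one> = \<one>" using ring_hom_memE(4)[OF fh] by simp
    moreover have "Irr E z \<noteq> []" using deg by auto
    ultimately have "map f (Irr E z) \<in> carrier (poly_ring L)"
      using I(3) ring_hom_memE(1)[OF fh] unfolding univ_poly_carrier[symmetric] polynomial_def
      by (auto simp: hd_map)
    then obtain w where w: "w \<in> carrier L" "eval (map f (Irr E z)) w = \<zero>"
      using eval_root_exists[of "map f (Irr E z)"] deg by (metis One_nat_def Suc_le_eq length_map)
    obtain E' f' where 2: "embedding E' f'" "E \<subseteq> E'" "\<And>a. a \<in> E \<Longrightarrow> f' a = f a" "z \<in> E'"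
      using embedding_extend[OF Ef(2) z w] by blast
    have "graph E f \<subseteq> graph E' f'" using 2(2,3) unfolding graph_def by auto
    then have "graph E' f' = graph E f" using max[of "graph E' f'"] 2(1) Ef(1,3) unfolding \<A>_def by blast
    then have "fst ` graph E' f' = fst ` graph E f" by simp
    then show "z \<in> E" using 2(4) unfolding graph_def by (simp add: image_image)
  qed
  then have "E = carrier L" using subringE(1)[OF E(1)] by blast
  moreover have "f a = f\<^sub>0 a" if "a \<in> E\<^sub>0" for a using Ef(3) that unfolding graph_def by auto
  ultimately show ?thesis using that Ef(2) by blast
qed

section \<open>Galois conjugates and roots of minimal polynomials\<close>

lemma finite_is_root_Irr:
  assumes "x \<in> carrier L"
  shows "finite {y. is_root (Irr K x) y}" "is_root (Irr K x) x"
proof -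
  note I = IrrE[OF subfield_axioms assms algebraic_extension[OF assms]]
  show "finite {y. is_root (Irr K x) y}"
    using finite_number_of_roots carrier_polynomial_shell[OF subfieldE(1)[OF subfield_axioms] I(1)] by blast
  have "Irr K x \<noteq> []" using pirreducible_degree[OF subfield_axioms I(1,2)] by auto
  then show "is_root (Irr K x) x" unfolding is_root_def using I(4) assms by blast
qed

lemma embedding_is_root_Irr:
  assumes "embedding (carrier L) f" "x \<in> carrier L" "is_root (Irr K x) y"
  shows "is_root (Irr K x) (f y)"
proof -
  have fh: "f \<in> ring_hom L L" and fK: "\<And>k. k \<in> K \<Longrightarrow> f k = k"
    using assms(1) unfolding embedding_def by auto
  interpret f: ring_hom_ring L L f using fh by (simp add: ring_hom_ringI2 ring_axioms)
  note I = IrrE[OF subfield_axioms assms(2) algebraic_extension[OF assms(2)]]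
  have "set (Irr K x) \<subseteq> K" using I(1) polynomial_incl unfolding univ_poly_carrier[symmetric] by blast
  then have "map f (Irr K x) = Irr K x" using fK by (simp add: map_idI subset_iff)
  then show ?thesis
    using f.eval_hom[OF subfieldE(1)[OF subfield_axioms] _ I(1), of y] assms(3) unfolding is_root_def by simp
qed

text \<open>Surjectivity is the point: \<open>f\<close> maps the finite root set of
  \<open>Irr K y\<close> injectively into itself, hence onto itself, and \<open>y\<close> is one of
  these roots.\<close>

lemma embedding_carrier_gal:
  assumes "embedding (carrier L) f"
  shows "(\<lambda>x. if x \<in> carrier L then f x else x) \<in> gal L K"
proof -
  have fh: "f \<in> ring_hom L L" and fK: "\<And>k. k \<in> K \<Longrightarrow> f k = k"
    using assms unfolding embedding_def by auto
  interpret f: ring_hom_ring L L f using fh by (simp add: ring_hom_ringI2 ring_axioms)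
  have inj: "inj_on f (carrier L)" 
  proof (rule f.non_trivial_field_hom_imp_inj[OF field_axioms])
    have "\<one> \<in> f ` carrier L" using f.hom_one one_closed by force
    then show "f ` carrier L \<noteq> {\<zero>}" using one_not_zero by (metis singletonD)
  qed
  have surj: "y \<in> f ` carrier L" if y: "y \<in> carrier L" for y
  proof -
    let ?R = "{z. is_root (Irr K y) z}"
    have "f ` ?R \<subseteq> ?R" using embedding_is_root_Irr[OF assms y] by blast
    moreover have Rc: "?R \<subseteq> carrier L" unfolding is_root_def by blast
    ultimately have "f ` ?R = ?R"
      using endo_inj_surj[OF finite_is_root_Irr(1)[OF y]] inj_on_subset[OF inj Rc] by blast
    then show ?thesis using finite_is_root_Irr(2)[OF y] Rc by blast
  qed
  have bij: "bij_betw f (carrier L) (carrier L)"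
    using inj surj f.hom_closed unfolding bij_betw_def by blast
  have "(\<lambda>x. if x \<in> carrier L then f x else x) \<in> ring_iso L L"
  proof (rule ring_iso_memI)
    show "bij_betw (\<lambda>x. if x \<in> carrier L then f x else x) (carrier L) (carrier L)"
      using bij by (simp cong: bij_betw_cong)
  qed auto
  then show ?thesis
    unfolding gal_def using fK subfieldE(3)[OF subfield_axioms] by auto
qed

text \<open>Start from the identity of \<open>K\<close>, extend it so that \<open>x\<close> goes to
  \<open>y\<close>, and then extend to all of \<open>L\<close>.\<close>

lemma gal_transitive_on_roots:
  assumes x: "x \<in> carrier L" and y: "is_root (Irr K x) y"
  obtains \<phi> where "\<phi> \<in> gal L K" "\<phi> x = y"
proof -
  have yc: "y \<in> carrier L" "eval (map id (Irr K x)) y = \<zero>" using y unfolding is_root_def by auto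
  have "id \<in> ring_hom (L\<lparr>carrier := K\<rparr>) L"
    using subfieldE(3)[OF subfield_axioms] by (auto intro!: ring_hom_memI)
  then have "embedding K id"
    unfolding embedding_def using subfieldE(1)[OF subfield_axioms] by simp
  then obtain E f where 1: "embedding E f" "x \<in> E" "f x = y"
    using embedding_extend[OF _ x yc] by metis
  obtain f' where 2: "embedding (carrier L) f'" "\<And>a. a \<in> E \<Longrightarrow> f' a = f a"
    using embedding_extend_to_carrier[OF 1(1)] by blast
  show ?thesis using that[OF embedding_carrier_gal[OF 2(1)]] 2(2)[OF 1(2)] 1(3) x by simp
qed

section \<open>The fixed field of the absolute Galois group\<close>

lemma gal_ring_hom: "\<phi> \<in> gal L K \<Longrightarrow> \<phi> \<in> ring_hom L L"
  unfolding gal_def ring_iso_def by simp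

lemma gal_ring_hom_ring: "\<phi> \<in> gal L K \<Longrightarrow> ring_hom_ring L L \<phi>"
  using gal_ring_hom by (simp add: ring_hom_ringI2 ring_axioms)

lemma gal_closed [simp]: "\<phi> \<in> gal L K \<Longrightarrow> x \<in> carrier L \<Longrightarrow> \<phi> x \<in> carrier L"
  using ring_hom_memE(1)[OF gal_ring_hom] .

lemma gal_mult [simp]:
  "\<phi> \<in> gal L K \<Longrightarrow> x \<in> carrier L \<Longrightarrow> y \<in> carrier L \<Longrightarrow> \<phi> (x \<otimes> y) = \<phi> x \<otimes> \<phi> y"
  using ring_hom_memE(2)[OF gal_ring_hom] .

lemma gal_base [simp]: "\<phi> \<in> gal L K \<Longrightarrow> k \<in> K \<Longrightarrow> \<phi> k = k"
  unfolding gal_def by simp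

lemma K_closed [simp]: "k \<in> K \<Longrightarrow> k \<in> carrier L"
  using subfieldE(3)[OF subfield_axioms] by blast

lemma gal_one [simp]: "\<phi> \<in> gal L K \<Longrightarrow> \<phi> \<one> = \<one>"
  using ring_hom_memE(4)[OF gal_ring_hom] .

lemma gal_pow [simp]: "\<phi> \<in> gal L K \<Longrightarrow> x \<in> carrier L \<Longrightarrow> \<phi> (x [^] (n::nat)) = \<phi> x [^] n"
  by (induct n) simp_all

lemma K_pow [simp]: "k \<in> K \<Longrightarrow> k [^] (n::nat) \<in> K"
  using subringE(3,6)[OF subfieldE(1)[OF subfield_axioms]] by (induct n) auto

text \<open>Being the identity off the carrier makes an automorphism bijective on the whole type, so
  that its inverse is simply \<open>inv_into UNIV\<close>.\<close>

lemma gal_bij: "\<phi> \<in> gal L K \<Longrightarrow> bij \<phi>"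
proof -
  assume s: "\<phi> \<in> gal L K"
  then have b: "bij_betw \<phi> (carrier L) (carrier L)"
    unfolding gal_def ring_iso_def by simp
  have "bij_betw \<phi> (- carrier L) (- carrier L)"
    using s unfolding gal_def bij_betw_def inj_on_def by force
  with b have "bij_betw \<phi> (carrier L \<union> - carrier L) (carrier L \<union> - carrier L)"
    by (intro bij_betw_combine) auto
  then show ?thesis by simp
qed

lemma gal_comp: "\<phi> \<in> gal L K \<Longrightarrow> \<tau> \<in> gal L K \<Longrightarrow> \<phi> \<circ> \<tau> \<in> gal L K"
  unfolding gal_def using ring_iso_set_trans by auto

lemma gal_id: "id \<in> gal L K"
  unfolding gal_def ring_iso_def ring_hom_def by simp

lemma gal_inv: assumes s: "\<phi> \<in> gal L K" shows "inv_into UNIV \<phi> \<in> gal L K"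
proof -
  define \<rho> where "\<rho> = inv_into UNIV \<phi>"
  have l: "\<rho> (\<phi> x) = x" and r: "\<phi> (\<rho> x) = x" for x
    using gal_bij[OF s] unfolding \<rho>_def bij_def by (simp_all add: surj_f_inv_f)
  have out: "x \<notin> carrier L \<Longrightarrow> \<phi> x = x" for x using s unfolding gal_def by blast
  have c: "\<rho> x \<in> carrier L" if "x \<in> carrier L" for x using out r that by metis
  have "\<rho> \<in> ring_iso L L"
  proof (rule ring_iso_memI)
    fix x y assume xy: "x \<in> carrier L" "y \<in> carrier L"
    show "\<rho> (x \<otimes> y) = \<rho> x \<otimes> \<rho> y"
      using l[of "\<rho> x \<otimes> \<rho> y"] r c xy s by simp
    show "\<rho> (x \<oplus> y) = \<rho> x \<oplus> \<rho> y"
      using l[of "\<rho> x \<oplus> \<rho> y"] r c xy ring_hom_memE(3)[OF gal_ring_hom[OF s]] by simp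
  next
    show "\<rho> \<one> = \<one>" using l[of \<one>] s by simp
    show "bij_betw \<rho> (carrier L) (carrier L)"
      by (rule bij_betwI[of _ _ _ \<phi>]) (use l r c s in auto)
  qed (use c in simp)
  moreover have "\<forall>x\<in>K. \<rho> x = x" using l s by (metis gal_base)
  moreover have "\<forall>x. x \<notin> carrier L \<longrightarrow> \<rho> x = x" using l out by metis
  ultimately show ?thesis unfolding gal_def \<rho>_def by simp
qed

lemma gal_orbit_is_root:
  assumes "\<phi> \<in> gal L K" "x \<in> carrier L"
  shows "is_root (Irr K x) (\<phi> x)"
proof (rule embedding_is_root_Irr[OF _ assms(2) finite_is_root_Irr(2)[OF assms(2)]])
  show "embedding (carrier L) \<phi>"
    unfolding embedding_def using assms(1) gal_ring_hom carrier_is_subring by auto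
qed

lemma finite_gal_orbit:
  "x \<in> carrier L \<Longrightarrow> finite ((\<lambda>\<phi>. \<phi> x) ` gal L K)"
  by (rule finite_subset[OF _ finite_is_root_Irr(1)[of x]]) (use gal_orbit_is_root in auto)

text \<open>Over the algebraically closed \<open>L\<close>, a polynomial whose only root is
  \<open>x\<close> is a constant times a power of X - x; one linear factor is split off per
  induction step. It serves to read off the constant term.\<close>

lemma eval_zero_single_root:
  assumes "P \<in> carrier (poly_ring L)" "P \<noteq> []" "x \<in> carrier L" "\<And>y. is_root P y \<Longrightarrow> y = x"
  shows "eval P \<zero> = lead_coeff P \<otimes> (\<ominus> x) [^] degree P"
  using assms
proof (induction "degree P" arbitrary: P)
  case 0
  then obtain a where "P = [a]" by (metis length_0_conv length_tl list.exhaust_sel)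
  moreover have "a \<in> carrier L" using 0(2) \<open>P = [a]\<close> unfolding univ_poly_carrier[symmetric] polynomial_def by simp
  ultimately show ?case by simp
next
  case (Suc n)
  let ?l = "[\<one>, \<ominus> x]"
  have l: "?l \<in> carrier (poly_ring L)"
    unfolding univ_poly_carrier[symmetric] polynomial_def using Suc(5) by simp
  obtain y where "y \<in> carrier L" "eval P y = \<zero>" using eval_root_exists[OF Suc(3)] Suc(2) by (metis zero_less_Suc)
  then have "is_root P x" using Suc(4,6) unfolding is_root_def by blast
  then have "?l pdivides P" using is_root_imp_pdivides[OF Suc(3)] by simp
  then obtain q where q: "q \<in> carrier (poly_ring L)" "P = ?l \<otimes>\<^bsub>poly_ring L\<^esub> q"
    unfolding pdivides_def factor_def by blast
  have pm: "P = poly_mult ?l q" using q(2) by (simp add: univ_poly_mult)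
  have qne: "q \<noteq> []" using pm Suc(4) poly_mult_zero(2)[of ?l] Suc(5) by auto
  have pl: "polynomial (carrier L) ?l" "polynomial (carrier L) q" using l q(1) by (simp_all add: univ_poly_carrier)
  have deg: "degree P = Suc (degree q)"
    using poly_mult_degree_eq[OF carrier_is_subring pl] qne unfolding pm by simp
  have sq: "set q \<subseteq> carrier L" "set ?l \<subseteq> carrier L" using pl polynomial_incl by blast+
  have lc: "lead_coeff q \<in> carrier L" using sq(1) qne by (meson hd_in_set subsetD)
  have lead: "lead_coeff P = lead_coeff q"
    using poly_mult_lead_coeff[OF carrier_is_subring pl _ qne] lc unfolding pm by simp
  have root: "y = x" if "is_root q y" for y
  proof (rule Suc(6))
    show "is_root P y" using that Suc(4) eval_poly_mult[OF sq(2,1), of y] eval_in_carrier[OF sq(2), of y]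
      unfolding is_root_def pm by simp
  qed
  have "eval q \<zero> = lead_coeff q \<otimes> (\<ominus> x) [^] degree q"
    using Suc(1)[OF _ q(1) qne Suc(5) root] Suc(2) deg by simp
  moreover have "eval P \<zero> = \<ominus> x \<otimes> eval q \<zero>"
    using eval_poly_mult[OF sq(2,1), of \<zero>] Suc(5) unfolding pm by simp
  ultimately show ?case unfolding deg lead using Suc(5) lc by (simp add: m_ac)
qed

text \<open>By transitivity \<open>x\<close> is the only root of \<open>Irr K x\<close>, so the
  constant term, which lies in \<open>K\<close>, is a power of \<open>\<ominus> x\<close>. Squaring
  removes the sign.\<close>

lemma gal_fixed_pow_in_base:
  assumes x: "x \<in> carrier L" and fixed: "\<And>\<phi>. \<phi> \<in> gal L K \<Longrightarrow> \<phi> x = x"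
  shows "\<exists>d>0. x [^] (d::nat) \<in> K"
proof -
  note I = IrrE[OF subfield_axioms x algebraic_extension[OF x]]
  note sK = subfieldE(1)[OF subfield_axioms]
  have deg: "degree (Irr K x) \<ge> 1" using pirreducible_degree[OF subfield_axioms I(1,2)] .
  have "y = x" if "is_root (Irr K x) y" for y
    using gal_transitive_on_roots[OF x that] fixed by metis
  then have "eval (Irr K x) \<zero> = \<one> \<otimes> (\<ominus> x) [^] degree (Irr K x)"
    using eval_zero_single_root[OF carrier_polynomial_shell[OF sK I(1)] _ x] deg I(3) by fastforce
  moreover have "eval (Irr K x) \<zero> \<in> K"
    using const_term_simprules_shell(1)[OF sK I(1)] unfolding const_term_def .
  ultimately have "(\<ominus> x) [^] degree (Irr K x) \<in> K" using x by simp
  then have "((\<ominus> x) [^] degree (Irr K x)) [^] (2::nat) \<in> K" by simp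
  moreover have "((\<ominus> x) [^] degree (Irr K x)) [^] (2::nat) = ((\<ominus> x) [^] (2::nat)) [^] degree (Irr K x)"
    using x by (simp add: nat_pow_pow mult.commute)
  moreover have "(\<ominus> x) [^] (2::nat) = x [^] (2::nat)"
    using x by (simp add: numeral_2_eq_2 l_minus r_minus)
  ultimately have "x [^] (2 * degree (Irr K x)) \<in> K" using x by (simp add: nat_pow_pow)
  then show ?thesis using deg by (intro exI[of _ "2 * degree (Irr K x)"]) auto
qed

section \<open>Radicals and descent to the base field\<close>

lemma pow_minus_const_polynomial:
  assumes E: "subring E L" "c \<in> E" and m: "m > 0"
  obtains q where "q \<in> carrier (E[X])" "degree q = m" "q \<noteq> []"
    "\<And>a. a \<in> carrier L \<Longrightarrow> eval q a = a [^] m \<ominus> c"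
proof -
  have E1: "\<one> \<in> E" "\<zero> \<in> E" "\<ominus> c \<in> E" "c \<in> carrier L" "\<one> \<in> carrier L"
    using subringE[OF E(1)] E(2) by auto
  \<comment> \<open>Coefficients are listed from the top degree down, so appending the constant term
    shifts X^(m-1) to X^m.\<close>
  define q where "q = monom \<one> (m - 1) @ [\<ominus> c]"
  have "eval q a = a [^] m \<ominus> c" if a: "a \<in> carrier L" for a
  proof -
    have "eval q a = eval (monom \<one> (m - 1)) a \<otimes> a \<oplus> \<ominus> c"
      unfolding q_def using eval_append_aux[OF monom_in_carrier _ a] E1 by simp
    also have "eval (monom \<one> (m - 1)) a \<otimes> a = a [^] Suc (m - 1)"
      using eval_monom[OF E1(5) a] a by simp
    finally show ?thesis using m by (simp add: a_minus_def)
  qed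
  moreover have "q \<in> carrier (E[X])"
    unfolding univ_poly_carrier[symmetric] polynomial_def q_def monom_def using E1 by auto
  moreover have "degree q = m" "q \<noteq> []" unfolding q_def monom_def using m by auto
  ultimately show ?thesis using that by blast
qed

lemma pow_inj_on_lessThan:
  assumes z: "\<zeta> \<in> carrier L" "\<zeta> [^] (m::nat) = \<one>"
    and prim: "\<And>k. 0 < k \<Longrightarrow> k < m \<Longrightarrow> \<zeta> [^] (k::nat) \<noteq> \<one>"
  shows "inj_on (\<lambda>j::nat. \<zeta> [^] j) {..<m}"
proof (rule linorder_inj_onI)
  fix i j :: nat assume ij: "i < j" "i \<in> {..<m}" "j \<in> {..<m}"
  show "\<zeta> [^] i \<noteq> \<zeta> [^] j"
  proof
    assume eq: "\<zeta> [^] i = \<zeta> [^] j"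
    have "\<zeta> [^] (m - j) \<otimes> \<zeta> [^] i = \<zeta> [^] (m - j) \<otimes> \<zeta> [^] j" using eq by simp
    then have "\<zeta> [^] (m - j + i) = \<zeta> [^] m" using z ij by (simp add: nat_pow_mult)
    moreover have "0 < m - j + i" "m - j + i < m" using ij by auto
    ultimately show False using prim z by metis
  qed
qed auto

lemma primitive_root_pow_inj:
  "primitive_root L K p \<zeta> \<Longrightarrow> inj_on (\<lambda>j::nat. \<zeta> [^] j) {..<p}"
  unfolding primitive_root_def by (intro pow_inj_on_lessThan) auto

text \<open>The \<open>p\<close> distinct elements \<open>\<zeta> [^] j \<otimes> y\<close> are
  roots of X^p - y^p, so \<open>y\<close> is a simple root. \<open>Irr K y\<close> divides this
  polynomial and has no root besides the fixed \<open>y\<close>; hence it is linear.\<close>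

lemma gal_fixed_root_in_base:
  assumes prim: "primitive_root L K p \<zeta>" and p: "prime p"
    and y: "y \<in> carrier L" and fixed: "\<And>\<phi>. \<phi> \<in> gal L K \<Longrightarrow> \<phi> y = y" and yp: "y [^] p \<in> K"
  shows "y \<in> K"
proof (cases "y = \<zero>")
  case True
  then show ?thesis using subringE(2)[OF subfieldE(1)[OF subfield_axioms]] by simp
next
  case False
  note sK = subfieldE(1)[OF subfield_axioms]
  have z: "\<zeta> \<in> carrier L" and p1: "\<zeta> [^] p = \<one>" using prim unfolding primitive_root_def by auto
  have p2: "p \<ge> 2" using prime_ge_2_nat[OF p] .
  note I = IrrE[OF subfield_axioms y algebraic_extension[OF y]]
  let ?I = "Irr K y"
  have IL: "?I \<in> carrier (poly_ring L)" using carrier_polynomial_shell[OF sK I(1)] .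
  obtain q where q: "q \<in> carrier (K[X])" and degq: "degree q = p" "q \<noteq> []"
    and evq: "\<And>a. a \<in> carrier L \<Longrightarrow> eval q a = a [^] p \<ominus> y [^] p"
    using pow_minus_const_polynomial[OF sK yp] p2 by (metis less_le_trans pos2)
  have qL: "q \<in> carrier (poly_ring L)" using carrier_polynomial_shell[OF sK q] .
  define A where "A = (\<lambda>j::nat. \<zeta> [^] j \<otimes> y) ` {..<p}"
  have cardA: "card A = p" "finite A"
  proof -
    have "inj_on (\<lambda>j::nat. \<zeta> [^] j \<otimes> y) {..<p}"
      using primitive_root_pow_inj[OF prim] False y z by (auto simp: inj_on_def m_rcancel)
    then show "card A = p" unfolding A_def using card_image by fastforce
    show "finite A" unfolding A_def by simp
  qed
  have yA: "y \<in> A" unfolding A_def using p2 y by (intro image_eqI[of _ _ 0]) auto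
  have Ar: "a \<in># roots q" if aA: "a \<in> A" for a
  proof -
    obtain j :: nat where "a = \<zeta> [^] j \<otimes> y" using aA unfolding A_def by blast
    moreover have "(\<zeta> [^] j \<otimes> y) [^] p = y [^] p" for j :: nat
      using z y p1 by (simp add: nat_pow_distrib nat_pow_pow mult.commute[of j p] flip: nat_pow_pow[of \<zeta> p j])
    ultimately show ?thesis
      unfolding roots_mem_iff_is_root[OF qL] is_root_def using evq[of a] degq y z by simp
  qed
  \<comment> \<open>Every element of \<open>A\<close> contributes at least 1 to a total multiplicity
    of at most \<open>p\<close>; this leaves no room for \<open>y\<close> to be a multiple
    root.\<close>
  have "count (roots q) y + (p - 1) \<le> (\<Sum>a\<in>A. count (roots q) a)"
  proof -
    have "(\<Sum>a\<in>A. count (roots q) a) = count (roots q) y + (\<Sum>a\<in>A - {y}. count (roots q) a)"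
      using yA cardA(2) by (simp add: sum.remove)
    moreover have "(\<Sum>a\<in>A - {y}. count (roots q) a) \<ge> (\<Sum>a\<in>A - {y}. 1)"
      by (rule sum_mono) (use Ar in \<open>simp add: Suc_le_eq\<close>)
    ultimately show ?thesis using cardA yA by (simp add: card_Diff_singleton)
  qed
  also have "\<dots> \<le> (\<Sum>a\<in>set_mset (roots q). count (roots q) a)"
    by (rule sum_mono2) (use Ar in auto)
  also have "\<dots> = size (roots q)" by (simp add: size_multiset_overloaded_eq)
  also have "\<dots> \<le> p" using size_roots_le_degree[OF qL] degq by simp
  finally have cnt: "count (roots q) y \<le> 1" using p2 by simp
  have "?I pdivides q" using Irr_minimal[OF subfield_axioms y algebraic_extension[OF y] q] evq[OF y] y by simp
  then have incl: "roots ?I \<subseteq># roots q" using pdivides_imp_roots_incl[OF IL qL degq(2)] by simp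
  have "a = y" if "a \<in># roots ?I" for a
    using gal_transitive_on_roots[OF y] that fixed unfolding roots_mem_iff_is_root[OF IL] by metis
  then have "set_mset (roots ?I) \<subseteq> {y}" by blast
  then have "size (roots ?I) = count (roots ?I) y"
    by (metis set_mset_subset_singletonD count_replicate_mset size_replicate_mset)
  also have "\<dots> \<le> 1" using mset_subset_eq_count[OF incl, of y] cnt by linarith
  finally have "degree ?I \<le> 1" using roots_over_carrier[OF IL] unfolding splitted_def by simp
  then have "degree ?I = 1" using pirreducible_degree[OF subfield_axioms I(1,2)] by simp
  then obtain b where b: "?I = [\<one>, b]" "b \<in> K" using degree_oneE[OF I(1)] I(3) by (metis list.sel(1))
  then have "y \<oplus> b = \<zero>" using I(4) y by simp
  then have "y = \<ominus> b" using y b(2) by (metis K_closed minus_equality)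
  then show ?thesis using subringE(5)[OF sK b(2)] by simp
qed

text \<open>Take the least exponent \<open>d\<close>. If \<open>p\<close> divided it, x^(d/p) would
  be a fixed element with its \<open>p\<close>-th power in \<open>K\<close>, hence itself in
  \<open>K\<close>, against minimality.\<close>

lemma gal_fixed_coprime_pow_in_base:
  assumes prim: "primitive_root L K p \<zeta>" and p: "prime p"
    and x: "x \<in> carrier L" and fixed: "\<And>\<phi>. \<phi> \<in> gal L K \<Longrightarrow> \<phi> x = x"
  shows "\<exists>m. \<not> p dvd m \<and> x [^] (m::nat) \<in> K"
proof -
  define d where "d = (LEAST d. d > 0 \<and> x [^] (d::nat) \<in> K)"
  have "\<exists>d>0. x [^] (d::nat) \<in> K" by (rule gal_fixed_pow_in_base[OF x]) (rule fixed)
  then have d: "d > 0" "x [^] d \<in> K" and least: "\<And>e. e > 0 \<Longrightarrow> x [^] (e::nat) \<in> K \<Longrightarrow> d \<le> e"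
    using LeastI_ex[of "\<lambda>d. d > 0 \<and> x [^] (d::nat) \<in> K"] Least_le[of "\<lambda>d. d > 0 \<and> x [^] (d::nat) \<in> K"]
    unfolding d_def by auto
  have "\<not> p dvd d"
  proof
    assume "p dvd d"
    then obtain e where e: "d = e * p" by (metis dvd_div_mult_self)
    have "x [^] e \<in> K"
    proof (rule gal_fixed_root_in_base[OF prim p])
      show "(x [^] e) [^] p \<in> K" using d(2) x e by (simp add: nat_pow_pow)
      show "\<phi> (x [^] e) = x [^] e" if "\<phi> \<in> gal L K" for \<phi>
        using gal_pow[OF that x] fixed[OF that] by simp
    qed (use x in simp)
    moreover have "e > 0" "e < d" using e d(1) prime_gt_1_nat[OF p] by auto
    ultimately show False using least[of e] by simp
  qed
  then show ?thesis using d(2) by blast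
qed

section \<open>Roots of unity\<close>

lemma exists_nth_root:
  assumes "c \<in> carrier L" "m > 0"
  shows "\<exists>b\<in>carrier L. b [^] (m::nat) = c"
proof -
  obtain q where "q \<in> carrier (poly_ring L)" "degree q = m"
    and ev: "\<And>a. a \<in> carrier L \<Longrightarrow> eval q a = a [^] m \<ominus> c"
    using pow_minus_const_polynomial[OF carrier_is_subring assms] by blast
  then obtain b where "b \<in> carrier L" "eval q b = \<zero>" using eval_root_exists[of q] assms(2) by blast
  then show ?thesis using ev[of b] assms(1) by auto
qed

lemma card_nth_roots_le:
  assumes "c \<in> carrier L" "m > 0" "A \<subseteq> carrier L" "\<And>a. a \<in> A \<Longrightarrow> a [^] (m::nat) = c"
  shows "card A \<le> m"
proof -
  obtain q where q: "q \<in> carrier (poly_ring L)" "degree q = m" "q \<noteq> []"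
    and ev: "\<And>a. a \<in> carrier L \<Longrightarrow> eval q a = a [^] m \<ominus> c"
    using pow_minus_const_polynomial[OF carrier_is_subring assms(1,2)] by blast
  have "A \<subseteq> set_mset (roots q)"
  proof
    fix a assume "a \<in> A"
    then have "a \<in> carrier L" "a [^] m = c" using assms(3,4) by auto
    then show "a \<in> set_mset (roots q)"
      using ev[of a] assms(1) q(3) unfolding roots_mem_iff_is_root[OF q(1)] is_root_def by simp
  qed
  then have "card A \<le> card (set_mset (roots q))" by (intro card_mono) auto
  also have "\<dots> \<le> size (roots q)"
    using sum_mono[of "set_mset (roots q)" "\<lambda>_. 1" "count (roots q)"]
    by (simp add: size_multiset_overloaded_eq Suc_le_eq)
  also have "\<dots> \<le> m" using size_roots_le_degree[OF q(1)] q(2) by simp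
  finally show ?thesis .
qed

text \<open>A primitive \<open>m\<close>-th root of unity of \<open>L\<close>, possibly outside
  \<open>K\<close>. Primitivity is phrased as distinctness of the powers, the form used for counting
  roots and comparing exponents.\<close>

definition root_of_unity_gen :: "nat \<Rightarrow> 'a \<Rightarrow> bool" where
  "root_of_unity_gen m \<xi> \<longleftrightarrow>
     \<xi> \<in> carrier L \<and> m > 0 \<and> \<xi> [^] m = \<one> \<and> inj_on (\<lambda>j::nat. \<xi> [^] j) {..<m}"

lemma primitive_root_imp_gen: "primitive_root L K p \<zeta> \<Longrightarrow> prime p \<Longrightarrow> root_of_unity_gen p \<zeta>"
  using primitive_root_pow_inj[of p \<zeta>] prime_gt_0_nat[of p]
  unfolding root_of_unity_gen_def primitive_root_def by auto

lemma root_of_unity_gen_pow_mod: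
  assumes "root_of_unity_gen m \<xi>"
  shows "\<xi> [^] (a mod m) = \<xi> [^] (a::nat)"
proof -
  have z: "\<xi> \<in> carrier L" "\<xi> [^] m = \<one>" using assms unfolding root_of_unity_gen_def by auto
  have "\<xi> [^] a = \<xi> [^] (m * (a div m) + a mod m)" by simp
  also have "\<dots> = (\<xi> [^] m) [^] (a div m) \<otimes> \<xi> [^] (a mod m)" using z(1) by (simp add: nat_pow_mult nat_pow_pow)
  finally show ?thesis using z by simp
qed

lemma root_of_unity_gen_pow_eq_iff:
  assumes "root_of_unity_gen m \<xi>"
  shows "\<xi> [^] (a::nat) = \<xi> [^] (b::nat) \<longleftrightarrow> a mod m = b mod m"
proof
  assume "\<xi> [^] a = \<xi> [^] b"
  then have "\<xi> [^] (a mod m) = \<xi> [^] (b mod m)" by (simp add: root_of_unity_gen_pow_mod[OF assms])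
  then show "a mod m = b mod m" using assms unfolding root_of_unity_gen_def inj_on_def by auto
next
  assume "a mod m = b mod m"
  then show "\<xi> [^] a = \<xi> [^] b" by (metis root_of_unity_gen_pow_mod[OF assms])
qed

text \<open>The powers of \<open>\<xi>\<close> already give \<open>m\<close> roots of X^m - 1; a
  further root would exceed the degree.\<close>

lemma root_of_unity_gen_surj:
  assumes g: "root_of_unity_gen m \<xi>" and y: "y \<in> carrier L" "y [^] m = \<one>"
  shows "\<exists>j::nat. y = \<xi> [^] j"
proof (rule ccontr)
  assume no: "\<not> ?thesis"
  have z: "\<xi> \<in> carrier L" "\<xi> [^] m = \<one>" "m > 0" "inj_on (\<lambda>j::nat. \<xi> [^] j) {..<m}"
    using g unfolding root_of_unity_gen_def by auto
  let ?A = "insert y ((\<lambda>j::nat. \<xi> [^] j) ` {..<m})"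
  have "(\<xi> [^] j) [^] m = \<one>" for j :: nat
  proof -
    have "(\<xi> [^] j) [^] m = (\<xi> [^] m) [^] j" using z(1) by (simp add: nat_pow_pow mult.commute)
    then show ?thesis using z(2) by simp
  qed
  then have "card ?A \<le> m" using z y by (intro card_nth_roots_le[of \<one>]) auto
  moreover have "card ?A = Suc m" using no card_image[OF z(4)] by (subst card_insert_disjoint) auto
  ultimately show False by simp
qed

lemma same_pow_imp_root_of_unity_mult:
  assumes g: "root_of_unity_gen m \<xi>" and xy: "x \<in> carrier L" "y \<in> carrier L" "y \<noteq> \<zero>" "x [^] m = y [^] m"
  shows "\<exists>j::nat. x = \<xi> [^] j \<otimes> y"
proof -
  have u: "y \<in> Units L" using xy by (simp add: field_Units)
  have i: "inv y \<in> carrier L" "inv y \<otimes> y = \<one>" using u by (simp_all add: Units_inv_closed)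
  have "(x \<otimes> inv y) [^] m = (inv y \<otimes> y) [^] m"
    using xy i(1) by (simp add: nat_pow_distrib m_comm)
  then have "(x \<otimes> inv y) [^] m = \<one>" using i(2) by simp
  then obtain j :: nat where "x \<otimes> inv y = \<xi> [^] j" using root_of_unity_gen_surj[OF g, of "x \<otimes> inv y"] xy i by blast
  then have "\<xi> [^] j \<otimes> y = x \<otimes> (inv y \<otimes> y)" using xy i(1) by (metis m_assoc)
  then show ?thesis using i(2) xy by force
qed

text \<open>If a smaller power of \<open>\<xi>\<close> were 1, Bezout would give a relation with
  exponent gcd(k, p^(M+1)), a proper divisor of p^(M+1) and so a divisor of p^M; this would force
  \<open>\<zeta> = \<one>\<close>.\<close>

lemma root_of_unity_gen_tower:
  assumes g: "root_of_unity_gen p \<zeta>" and p: "prime p" and x: "\<xi> \<in> carrier L" "\<xi> [^] (p ^ M) = \<zeta>"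
  shows "root_of_unity_gen (p ^ Suc M) \<xi>"
proof -
  have z: "\<zeta> [^] p = \<one>" using g unfolding root_of_unity_gen_def by auto
  have one: "\<xi> [^] (p ^ Suc M) = \<one>"
    using z x nat_pow_pow[OF x(1), of "p ^ M" p] by (simp add: mult.commute)
  have "\<xi> [^] k \<noteq> \<one>" if k: "0 < k" "k < p ^ Suc M" for k :: nat
  proof
    assume k1: "\<xi> [^] k = \<one>"
    obtain a b where ab: "k * a = p ^ Suc M * b + gcd k (p ^ Suc M)" using bezout_nat k(1) by blast
    define d where "d = gcd k (p ^ Suc M)"
    have "\<xi> [^] (k * a) = \<one>" using nat_pow_pow[OF x(1), of k a] k1 by simp
    moreover have "\<xi> [^] (p ^ Suc M * b) = \<one>" using nat_pow_pow[OF x(1), of "p ^ Suc M" b] one by simp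
    ultimately have d1: "\<xi> [^] d = \<one>" using ab x(1) nat_pow_mult[OF x(1), of "p ^ Suc M * b" d] unfolding d_def by simp
    have "d dvd p ^ Suc M" unfolding d_def by simp
    then obtain e where e: "e \<le> Suc M" "d = p ^ e" using divides_primepow_nat[OF p] by blast
    have "d \<le> k" unfolding d_def using k(1) by (simp add: dvd_imp_le)
    then have "e \<noteq> Suc M" using k(2) e(2) by auto
    then have "d dvd p ^ M" using e by (simp add: le_imp_power_dvd)
    then obtain c where "p ^ M = d * c" by (rule dvdE)
    then have "\<zeta> = \<one>" using x nat_pow_pow[OF x(1), of d c] d1 by simp
    then have "\<zeta> [^] (0::nat) = \<zeta> [^] (1::nat)" by simp
    then show False unfolding root_of_unity_gen_pow_eq_iff[OF g] using prime_gt_1_nat[OF p] by simp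
  qed
  then show ?thesis
    unfolding root_of_unity_gen_def using x one prime_gt_0_nat[OF p] pow_inj_on_lessThan[OF x(1) one] by simp
qed

end

section \<open>Kummer theory\<close>

text \<open>Dedekind's argument: subtracting \<open>s w\<close> times the relation at
  \<open>y\<close> from the relation at \<open>w \<otimes> y\<close> cancels the term of
  \<open>s\<close> and leaves a shorter relation with coefficients
  \<open>c t \<otimes> (t w \<ominus> s w)\<close>. The characters live on a submonoid
  \<open>E\<close>, later a fixed field.\<close>

lemma (in domain) linear_independence_of_characters:
  assumes "finite T" and E: "E \<subseteq> carrier R" "\<one> \<in> E" "\<And>x y. x \<in> E \<Longrightarrow> y \<in> E \<Longrightarrow> x \<otimes> y \<in> E"
    and "\<And>t x. t \<in> T \<Longrightarrow> x \<in> E \<Longrightarrow> t x \<in> carrier R"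
    and "\<And>t x y. t \<in> T \<Longrightarrow> x \<in> E \<Longrightarrow> y \<in> E \<Longrightarrow> t (x \<otimes> y) = t x \<otimes> t y"
    and "\<And>t. t \<in> T \<Longrightarrow> t \<one> = \<one>"
    and "\<And>t u. t \<in> T \<Longrightarrow> u \<in> T \<Longrightarrow> t \<noteq> u \<Longrightarrow> \<exists>x\<in>E. t x \<noteq> u x"
    and "\<And>t. t \<in> T \<Longrightarrow> c t \<in> carrier R"
    and "\<And>y. y \<in> E \<Longrightarrow> (\<Oplus>t\<in>T. c t \<otimes> t y) = \<zero>"
  shows "\<forall>t\<in>T. c t = \<zero>"
  using assms(1,5-)
proof (induction T arbitrary: c rule: finite_induct)
  case empty
  then show ?case by simp
next
  case (insert s T)
  have clE: "x \<in> carrier R" if "x \<in> E" for x using that E(1) by blast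
  have tc [simp]: "t x \<in> carrier R" if "t \<in> insert s T" "x \<in> E" for t x using insert.prems(1) that .
  have cc [simp]: "c t \<in> carrier R" if "t \<in> insert s T" for t using insert.prems(5) that .
  have split: "c s \<otimes> s y \<oplus> (\<Oplus>t\<in>T. c t \<otimes> t y) = \<zero>" if y: "y \<in> E" for y
  proof -
    have "(\<Oplus>t\<in>insert s T. c t \<otimes> t y) = c s \<otimes> s y \<oplus> (\<Oplus>t\<in>T. c t \<otimes> t y)"
      by (rule finsum_insert) (use insert.hyps y in auto)
    then show ?thesis using insert.prems(6)[OF y] by simp
  qed
  have zero: "c t = \<zero>" if t: "t \<in> T" for t
  proof -
    obtain w where w: "w \<in> E" "t w \<noteq> s w" using insert.prems(4)[of t s] t insert.hyps(2) by blast
    have "\<forall>t\<in>T. c t \<otimes> (t w \<ominus> s w) = \<zero>"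
    proof (rule insert.IH)
      fix y assume y: "y \<in> E"
      define A where "A = (\<Oplus>t\<in>T. c t \<otimes> (t w \<ominus> s w) \<otimes> t y)"
      define B where "B = (\<Oplus>t\<in>T. c t \<otimes> t y)"
      have Ac: "A \<in> carrier R" unfolding A_def using w y by (intro finsum_closed) auto
      have Bc: "B \<in> carrier R" unfolding B_def using y by (intro finsum_closed) auto
      have "(\<Oplus>t\<in>T. c t \<otimes> t (w \<otimes> y)) = (\<Oplus>t\<in>T. c t \<otimes> (t w \<ominus> s w) \<otimes> t y \<oplus> s w \<otimes> (c t \<otimes> t y))"
      proof (rule finsum_cong')
        fix t assume t: "t \<in> T"
        have "t (w \<otimes> y) = t w \<otimes> t y" using insert.prems(2) t w y by blast
        moreover have "t w \<in> carrier R" "s w \<in> carrier R" "t y \<in> carrier R" "c t \<in> carrier R" using t w y by auto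
        ultimately show "c t \<otimes> t (w \<otimes> y) = c t \<otimes> (t w \<ominus> s w) \<otimes> t y \<oplus> s w \<otimes> (c t \<otimes> t y)"
          by algebra
      qed (use w y in auto)
      also have "\<dots> = A \<oplus> (\<Oplus>t\<in>T. s w \<otimes> (c t \<otimes> t y))"
        unfolding A_def by (rule finsum_addf) (use w y in auto)
      also have "(\<Oplus>t\<in>T. s w \<otimes> (c t \<otimes> t y)) = s w \<otimes> B"
        unfolding B_def by (rule finsum_rdistr[symmetric]) (use w y insert.hyps in auto)
      finally have "c s \<otimes> s (w \<otimes> y) \<oplus> (A \<oplus> s w \<otimes> B) = \<zero>" using split[OF E(3)[OF w(1) y]] by simp
      moreover have "s (w \<otimes> y) = s w \<otimes> s y" using insert.prems(2) w y by blast
      moreover have "c s \<otimes> s y \<oplus> B = \<zero>" using split[OF y] unfolding B_def .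
      moreover have "c s \<otimes> (s w \<otimes> s y) \<oplus> (A \<oplus> s w \<otimes> B) = A \<oplus> s w \<otimes> (c s \<otimes> s y \<oplus> B)"
      proof -
        have "c s \<in> carrier R" "s w \<in> carrier R" "s y \<in> carrier R" using w y by auto
        then show ?thesis using Ac Bc by algebra
      qed
      ultimately have "A = \<zero>" using Ac w by simp
      then show "(\<Oplus>t\<in>T. c t \<otimes> (t w \<ominus> s w) \<otimes> t y) = \<zero>" unfolding A_def .
    qed (use insert.prems(1-4) w t in auto)
    moreover have "t w \<ominus> s w \<noteq> \<zero>" using w t by simp
    ultimately show ?thesis using integral[of "c t" "t w \<ominus> s w"] t w by simp
  qed
  have "(\<Oplus>t\<in>T. c t \<otimes> t \<one>) = (\<Oplus>t\<in>T. \<zero>)" by (rule finsum_cong') (use zero E in auto)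
  then have "c s = \<zero>" using split[OF E(2)] insert.prems(3)[of s] by simp
  then show ?case using zero by blast
qed

lemma (in domain) nat_pow_nonzero:
  "x \<in> carrier R \<Longrightarrow> x \<noteq> \<zero> \<Longrightarrow> x [^] (n::nat) \<noteq> \<zero>"
  by (induct n) (auto simp: integral_iff)

context algebraic_closure
begin

lemma primitive_root_int_pow_add:
  assumes "primitive_root L K p \<zeta>" "prime p" "(a + b) mod int p = c mod int p"
  shows "\<zeta> [^] nat (c mod int p) = \<zeta> [^] nat (a mod int p) \<otimes> \<zeta> [^] nat (b mod int p)"
proof -
  have z: "\<zeta> \<in> carrier L" using assms unfolding primitive_root_def by auto
  have p: "int p > 0" using prime_gt_0_nat[OF assms(2)] by simp
  have "int ((nat (a mod int p) + nat (b mod int p)) mod p) = (a + b) mod int p"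
    using p by (simp add: zmod_int mod_add_eq)
  then have "nat (c mod int p) = (nat (a mod int p) + nat (b mod int p)) mod p"
    using assms(3) by (metis nat_int)
  then show ?thesis using z root_of_unity_gen_pow_mod[OF primitive_root_imp_gen[OF assms(1,2)]] by (simp add: nat_pow_mult)
qed

text \<open>The Lagrange resolvent of a character, summed over the cosets of an open subgroup in its kernel.\<close>
lemma lagrange_resolvent:
  assumes prim: "primitive_root L K p \<zeta>" and p: "prime p" and coc: "cocycle1 L K p \<alpha>"
  obtains \<beta> where "\<beta> \<in> carrier L" "\<beta> \<noteq> \<zero>"
    "\<And>\<phi>. \<phi> \<in> gal L K \<Longrightarrow> \<phi> \<beta> = \<zeta> [^] nat (\<alpha> \<phi> mod int p) \<otimes> \<beta>"
proof -
  have \<zeta>: "\<zeta> \<in> carrier L" "\<zeta> [^] p = \<one>" using prim unfolding primitive_root_def by auto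
  define z where "z \<phi> = \<zeta> [^] nat (\<alpha> \<phi> mod int p)" for \<phi>
  have zK: "z \<phi> \<in> K" for \<phi> using prim unfolding z_def primitive_root_def by simp
  have zc [simp]: "z \<phi> \<in> carrier L" for \<phi> using zK by simp
  have zmult: "z (\<phi> \<circ> \<tau>) = z \<phi> \<otimes> z \<tau>" if "\<phi> \<in> gal L K" "\<tau> \<in> gal L K" for \<phi> \<tau>
    unfolding z_def
  proof (rule primitive_root_int_pow_add[OF prim p])
    have "(\<alpha> \<tau> - \<alpha> (\<phi> \<circ> \<tau>) + \<alpha> \<phi>) mod int p = 0" using coc that unfolding cocycle1_def by blast
    then show "(\<alpha> \<phi> + \<alpha> \<tau>) mod int p = \<alpha> (\<phi> \<circ> \<tau>) mod int p"
      by (simp add: mod_eq_dvd_iff mod_eq_0_iff_dvd algebra_simps)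
  qed
  have znz: "z \<phi> \<noteq> \<zero>" for \<phi>
  proof
    assume "z \<phi> = \<zero>"
    moreover have "(\<zeta> [^] nat (\<alpha> \<phi> mod int p)) [^] p = (\<zeta> [^] p) [^] nat (\<alpha> \<phi> mod int p)"
      using \<zeta>(1) by (simp add: nat_pow_pow mult.commute)
    moreover note \<zeta>(2)
    ultimately show False using prime_gt_0_nat[OF p] unfolding z_def by (simp add: nat_pow_zero)
  qed
  have zid: "z id = \<one>"
    using zmult[OF gal_id gal_id] m_lcancel[OF znz[of id] zc zc[of id], of \<one>] by simp
  \<comment> \<open>Continuity at the identity: the character is trivial on the open subgroup
    \<open>H\<close> fixing \<open>S\<close> pointwise. \<open>E\<close> is the fixed field of
    \<open>H\<close>.\<close>
  obtain S where S: "finite S" "S \<subseteq> carrier L"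
    and Sid: "\<And>\<tau>. \<tau> \<in> gal L K \<Longrightarrow> (\<And>x. x \<in> S \<Longrightarrow> \<tau> x = x) \<Longrightarrow> \<alpha> \<tau> mod int p = \<alpha> id mod int p"
    using coc gal_id unfolding cocycle1_def cont1_def by (metis id_apply)
  define H where "H = {\<rho> \<in> gal L K. \<forall>x\<in>S. \<rho> x = x}"
  define E where "E = {y \<in> carrier L. \<forall>\<rho>\<in>H. \<rho> y = y}"
  have SE: "S \<subseteq> E" using S unfolding E_def H_def by blast
  \<comment> \<open>Two automorphisms agreeing on \<open>S\<close> differ by an element of
    \<open>H\<close>, so they share both the value of \<open>z\<close> and the action on
    \<open>E\<close>.\<close>
  have agree: "z \<phi> = z \<tau> \<and> (\<forall>y\<in>E. \<phi> y = \<tau> y)"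
    if \<phi>: "\<phi> \<in> gal L K" and \<tau>: "\<tau> \<in> gal L K" and eq: "\<And>x. x \<in> S \<Longrightarrow> \<phi> x = \<tau> x" for \<phi> \<tau>
  proof -
    define \<rho> where "\<rho> = inv_into UNIV \<phi> \<circ> \<tau>"
    have \<rho>: "\<rho> \<in> gal L K" unfolding \<rho>_def using gal_comp[OF gal_inv[OF \<phi>] \<tau>] .
    have "\<phi> (inv_into UNIV \<phi> x) = x" for x
      using gal_bij[OF \<phi>] by (simp add: bij_is_surj surj_f_inv_f)
    then have c: "\<phi> \<circ> \<rho> = \<tau>" unfolding \<rho>_def by auto
    have "\<rho> x = x" if "x \<in> S" for x
      unfolding \<rho>_def using eq[OF that] gal_bij[OF \<phi>] by (metis bij_is_inj comp_apply inv_f_f)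
    then have \<rho>H: "\<rho> \<in> H" unfolding H_def using \<rho> by blast
    then have "z \<rho> = z id" unfolding z_def using Sid[OF \<rho>] unfolding H_def by simp
    then have "z \<tau> = z \<phi>" using zmult[OF \<phi> \<rho>] zid c by simp
    moreover have "\<phi> y = \<tau> y" if "y \<in> E" for y
    proof -
      have "\<rho> y = y" using \<rho>H that unfolding E_def by blast
      then show ?thesis unfolding c[symmetric] by simp
    qed
    ultimately show ?thesis by simp
  qed
  \<comment> \<open>Restrictions to \<open>S\<close> label the cosets of \<open>H\<close>. There are
    finitely many, as orbits of elements of \<open>S\<close> are finite; \<open>T\<close> picks one
    representative for each.\<close>
  define res where "res \<phi> = restrict \<phi> S" for \<phi> :: "'a \<Rightarrow> 'a"
  have res_eq: "res \<phi> = res \<tau> \<longleftrightarrow> (\<forall>x\<in>S. \<phi> x = \<tau> x)" for \<phi> \<tau>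
    unfolding res_def by (metis restrict_ext restrict_apply')
  have "res ` gal L K \<subseteq> PiE S (\<lambda>s. (\<lambda>\<phi>. \<phi> s) ` gal L K)" unfolding res_def by auto
  moreover have "finite (PiE S (\<lambda>s. (\<lambda>\<phi>. \<phi> s) ` gal L K))"
    using S finite_gal_orbit by (intro finite_PiE) auto
  ultimately have finres: "finite (res ` gal L K)" by (rule finite_subset)
  obtain T where T: "T \<subseteq> gal L K" "inj_on res T" "res ` gal L K = res ` T"
    using subset_image_inj[of "res ` gal L K" res "gal L K"] by auto
  have finT: "finite T" using finres T(2,3) by (simp add: finite_image_iff)
  have Tg [simp]: "t \<in> gal L K" if "t \<in> T" for t using T(1) that by blast
  have Ec: "E \<subseteq> carrier L" unfolding E_def by blast
  \<comment> \<open>With the inverse character values as coefficients, applying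
    \<open>\<phi>\<close> to the sum permutes its terms and pulls out the factor
    \<open>z \<phi>\<close>.\<close>
  define c where "c t = inv (z t)" for t
  have cc: "c t \<in> carrier L" "c t \<noteq> \<zero>" for t
  proof -
    have u: "z t \<in> Units L" using znz by (simp add: field_Units)
    show "c t \<in> carrier L" unfolding c_def using u by (rule Units_inv_closed)
    show "c t \<noteq> \<zero>" unfolding c_def using Units_r_inv[OF u] one_not_zero zc r_null by metis
  qed
  \<comment> \<open>If the resolvent vanished on all of \<open>E\<close>, independence of characters
    would kill the nonzero coefficients; distinct members of \<open>T\<close> already differ on
    \<open>S\<close>, which lies in \<open>E\<close>.\<close>
  obtain y where y: "y \<in> E" "(\<Oplus>t\<in>T. c t \<otimes> t y) \<noteq> \<zero>"
  proof (rule ccontr)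
    assume *: "\<not> thesis"
    obtain t where t: "t \<in> T" using T(3) gal_id by blast
    have "\<forall>t\<in>T. c t = \<zero>"
    proof (rule linear_independence_of_characters[OF finT Ec])
      show "\<one> \<in> E" unfolding E_def H_def by simp
      show "x \<otimes> y \<in> E" if xy: "x \<in> E" "y \<in> E" for x y
      proof -
        have "\<rho> (x \<otimes> y) = x \<otimes> y" if "\<rho> \<in> H" for \<rho>
        proof -
          have "\<rho> x = x" "\<rho> y = y" "x \<in> carrier L" "y \<in> carrier L" using xy that unfolding E_def by blast+
          moreover have "\<rho> \<in> gal L K" using that unfolding H_def by blast
          ultimately show ?thesis by simp
        qed
        then show ?thesis using xy unfolding E_def by simp
      qed
      show "\<exists>x\<in>E. t x \<noteq> u x" if "t \<in> T" "u \<in> T" "t \<noteq> u" for t u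
        using T(2) that SE res_eq unfolding inj_on_def by blast
      show "(\<Oplus>t\<in>T. c t \<otimes> t y) = \<zero>" if "y \<in> E" for y using * that \<open>\<And>y. y \<in> E \<Longrightarrow> (\<Oplus>t\<in>T. c t \<otimes> t y) \<noteq> \<zero> \<Longrightarrow> thesis\<close> by blast
      show "t (x \<otimes> y) = t x \<otimes> t y" if "t \<in> T" "x \<in> E" "y \<in> E" for t x y
        using gal_mult[OF Tg] Ec that by blast
      show "t x \<in> carrier L" if "t \<in> T" "x \<in> E" for t x
        using gal_closed[OF Tg] Ec that by blast
      show "t \<one> = \<one>" if "t \<in> T" for t using gal_one[OF Tg[OF that]] .
    qed (rule cc)
    then show False using cc t by blast
  qed
  have yc: "y \<in> carrier L" using y Ec by blast
  define \<beta> where "\<beta> = (\<Oplus>t\<in>T. c t \<otimes> t y)"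
  have \<beta>c: "\<beta> \<in> carrier L" unfolding \<beta>_def using cc yc by (intro finsum_closed) auto
  have "\<phi> \<beta> = z \<phi> \<otimes> \<beta>" if \<phi>: "\<phi> \<in> gal L K" for \<phi>
  proof -
    interpret \<phi>: ring_hom_ring L L \<phi> using gal_ring_hom_ring[OF \<phi>] .
    \<comment> \<open>\<open>\<phi>\<close> permutes the cosets of \<open>H\<close>;
      \<open>\<pi> t\<close> represents the coset of \<open>\<phi> \<circ> t\<close>.\<close>
    define \<pi> where "\<pi> t = (SOME u. u \<in> T \<and> res u = res (\<phi> \<circ> t))" for t
    have \<pi>: "\<pi> t \<in> T" "res (\<pi> t) = res (\<phi> \<circ> t)" if "t \<in> T" for t
    proof -
      have "res (\<phi> \<circ> t) \<in> res ` T" using T(3) gal_comp[OF \<phi> Tg[OF that]] by blast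
      then have "\<exists>u. u \<in> T \<and> res u = res (\<phi> \<circ> t)" by force
      from someI_ex[OF this] show "\<pi> t \<in> T" "res (\<pi> t) = res (\<phi> \<circ> t)" unfolding \<pi>_def by auto
    qed
    have inj: "inj_on \<pi> T"
    proof (rule inj_onI)
      fix t u assume tu: "t \<in> T" "u \<in> T" "\<pi> t = \<pi> u"
      then have "\<forall>x\<in>S. \<phi> (t x) = \<phi> (u x)" using \<pi>[OF tu(1)] \<pi>[OF tu(2)] res_eq by (metis comp_apply)
      then have "res t = res u" using gal_bij[OF \<phi>] unfolding res_eq bij_def by (simp add: inj_eq)
      then show "t = u" using T(2) tu by (simp add: inj_on_def)
    qed
    then have im: "\<pi> ` T = T" using endo_inj_surj[OF finT _ inj] \<pi>(1) by blast
    have "\<phi> \<beta> = (\<Oplus>t\<in>T. \<phi> (c t \<otimes> t y))"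
      unfolding \<beta>_def using cc yc by (subst \<phi>.hom_finsum) (auto simp: comp_def)
    also have "\<dots> = (\<Oplus>t\<in>T. z \<phi> \<otimes> (c (\<pi> t) \<otimes> \<pi> t y))"
    proof (rule finsum_cong')
      fix t assume t: "t \<in> T"
      have "z (\<pi> t) = z (\<phi> \<circ> t) \<and> (\<forall>y\<in>E. \<pi> t y = (\<phi> \<circ> t) y)"
        using agree[OF Tg[OF \<pi>(1)[OF t]] gal_comp[OF \<phi> Tg[OF t]]] \<pi>(2)[OF t] unfolding res_eq by blast
      then have 1: "z (\<pi> t) = z \<phi> \<otimes> z t" "\<pi> t y = \<phi> (t y)" using zmult[OF \<phi> Tg[OF t]] y by auto
      have "\<phi> (c t) = c t" using subfield_m_inv(1)[OF subfield_axioms, of "z t"] zK znz \<phi> unfolding c_def by simp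
      moreover have "z \<phi> \<otimes> c (\<pi> t) = c t"
      proof -
        have "z t \<otimes> (z \<phi> \<otimes> c (\<pi> t)) = z (\<pi> t) \<otimes> c (\<pi> t)"
          using cc unfolding 1(1) by (simp add: m_ac)
        also have "\<dots> = \<one>" unfolding c_def using znz by (intro Units_r_inv) (simp add: field_Units)
        finally show ?thesis 
          unfolding c_def[of t] using cc comm_inv_char[of "z t" "z \<phi> \<otimes> c (\<pi> t)"] by simp
      qed
      moreover have "\<phi> (t y) \<in> carrier L" using \<phi> t yc by simp
      ultimately show "\<phi> (c t \<otimes> t y) = z \<phi> \<otimes> (c (\<pi> t) \<otimes> \<pi> t y)"
        using 1(2) \<phi> t yc cc by (simp add: m_assoc[symmetric])
    qed (use cc yc \<pi> in auto)
    also have "\<dots> = z \<phi> \<otimes> (\<Oplus>t\<in>T. c (\<pi> t) \<otimes> \<pi> t y)"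
      by (rule finsum_rdistr[symmetric]) (use finT cc yc \<pi> in auto)
    also have "(\<Oplus>t\<in>T. c (\<pi> t) \<otimes> \<pi> t y) = (\<Oplus>t\<in>\<pi> ` T. c t \<otimes> t y)"
      by (rule finsum_reindex[symmetric]) (use inj im cc yc in auto)
    finally show ?thesis unfolding im \<beta>_def .
  qed
  then show ?thesis using that[OF \<beta>c] y(2) unfolding \<beta>_def z_def by blast
qed

text \<open>The \<open>p\<close>-th power of the resolvent is Galois-fixed, so an
  \<open>m\<close>-th power of it with \<open>m\<close> prime to \<open>p\<close> lies in
  \<open>K\<close>. This multiplies the character by \<open>m\<close>; a further power
  \<open>r\<close>, inverse to \<open>m\<close> modulo \<open>p\<close>, restores it.\<close>

lemma cocycle_is_kummer:
  assumes prim: "primitive_root L K p \<zeta>" and p: "prime p" and coc: "cocycle1 L K p \<alpha>"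
  obtains b where "b \<in> K - {\<zero>}" "kummer_char L K p \<zeta> b \<alpha>"
proof -
  obtain \<beta> where \<beta>: "\<beta> \<in> carrier L" "\<beta> \<noteq> \<zero>"
    and act: "\<And>\<phi>. \<phi> \<in> gal L K \<Longrightarrow> \<phi> \<beta> = \<zeta> [^] nat (\<alpha> \<phi> mod int p) \<otimes> \<beta>"
    using lagrange_resolvent[OF assms] by blast
  have z: "\<zeta> \<in> carrier L" "\<zeta> [^] p = \<one>" using prim unfolding primitive_root_def by auto
  have "\<phi> (\<beta> [^] p) = \<beta> [^] p" if "\<phi> \<in> gal L K" for \<phi>
  proof -
    have "\<phi> (\<beta> [^] p) = (\<zeta> [^] p) [^] nat (\<alpha> \<phi> mod int p) \<otimes> \<beta> [^] p"
      using gal_pow[OF that \<beta>(1)] act[OF that] z(1) \<beta>(1) by (simp add: nat_pow_distrib nat_pow_pow mult.commute)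
    then show ?thesis using z \<beta> by simp
  qed
  then obtain m where m: "\<not> p dvd m" "(\<beta> [^] p) [^] m \<in> K"
    using gal_fixed_coprime_pow_in_base[OF prim p nat_pow_closed[OF \<beta>(1)]] by blast
  have "gcd m p = 1" "m \<noteq> 0"
    using m(1) prime_imp_coprime[OF p, of m] by (auto simp: coprime_iff_gcd_eq_1 gcd.commute intro!: gr0I)
  then obtain r k where "m * r = p * k + 1" using bezout_nat[of m p] by metis
  then have r: "m * r mod p = 1 mod p" by (metis mod_mult_self2 add.commute)
  define b where "b = (\<beta> [^] (m * r)) [^] p"
  have "b = ((\<beta> [^] p) [^] m) [^] r" unfolding b_def using \<beta> by (simp add: nat_pow_pow ac_simps)
  then have "b \<in> K" using m(2) by simp
  moreover have "b \<noteq> \<zero>"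
    unfolding b_def using \<beta> by (simp add: nat_pow_pow nat_pow_nonzero)
  moreover have "\<phi> (\<beta> [^] (m * r)) = \<zeta> [^] nat (\<alpha> \<phi> mod int p) \<otimes> \<beta> [^] (m * r)" if "\<phi> \<in> gal L K" for \<phi>
  proof -
    let ?a = "nat (\<alpha> \<phi> mod int p)"
    have "\<phi> (\<beta> [^] (m * r)) = \<zeta> [^] (?a * (m * r)) \<otimes> \<beta> [^] (m * r)"
      using gal_pow[OF that \<beta>(1)] act[OF that] z(1) \<beta>(1) by (simp add: nat_pow_distrib nat_pow_pow)
    also have "\<zeta> [^] (?a * (m * r)) = \<zeta> [^] ?a"
      using root_of_unity_gen_pow_mod[OF primitive_root_imp_gen[OF prim p]] r by (metis mod_mult_right_eq mult.right_neutral)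
    finally show ?thesis .
  qed
  ultimately show ?thesis
    using that[of b] nat_pow_closed[OF \<beta>(1)] unfolding kummer_char_def b_def by blast
qed

text \<open>The affine action modulo p^(M+1) on the exponents of \<open>\<xi>\<close> and
  \<open>b\<close> is recorded by \<open>u\<close> and \<open>v\<close>. Raising to the power p^M
  reads off their residues modulo \<open>p\<close>: \<open>u\<close> is 1 because
  \<open>\<zeta>\<close> is fixed, and \<open>v\<close> is \<open>\<alpha>\<close>.\<close>

lemma kummer_tower:
  assumes g: "root_of_unity_gen p \<zeta>" and zK: "\<zeta> \<in> K" and p: "prime p" and \<beta>: "\<beta> \<in> carrier L" "\<beta> \<noteq> \<zero>"
    and act: "\<And>\<phi>. \<phi> \<in> gal L K \<Longrightarrow> \<phi> \<beta> = \<zeta> [^] nat (\<alpha> \<phi> mod int p) \<otimes> \<beta>"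
  obtains v u :: "('a \<Rightarrow> 'a) \<Rightarrow> nat" and S where "finite S" "S \<subseteq> carrier L"
    "\<And>\<phi> \<tau>. \<forall>x\<in>S. \<tau> x = \<phi> x \<Longrightarrow> v \<tau> = v \<phi> \<and> u \<tau> = u \<phi>"
    "\<And>\<phi>. \<phi> \<in> gal L K \<Longrightarrow> u \<phi> mod p = 1 mod p"
    "\<And>\<phi>. \<phi> \<in> gal L K \<Longrightarrow> int (v \<phi>) mod int p = \<alpha> \<phi> mod int p"
    "\<And>\<phi> \<tau>. \<phi> \<in> gal L K \<Longrightarrow> \<tau> \<in> gal L K \<Longrightarrow> v (\<phi> \<circ> \<tau>) mod p ^ Suc M = (v \<phi> + u \<phi> * v \<tau>) mod p ^ Suc M"
    "\<And>\<phi> \<tau>. \<phi> \<in> gal L K \<Longrightarrow> \<tau> \<in> gal L K \<Longrightarrow> u (\<phi> \<circ> \<tau>) mod p ^ Suc M = (u \<phi> * u \<tau>) mod p ^ Suc M"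
proof -
  have pM: "p ^ M > 0" using prime_gt_0_nat[OF p] by simp
  obtain b where b: "b \<in> carrier L" "b [^] (p ^ M) = \<beta>" using exists_nth_root[OF \<beta>(1) pM] by blast
  obtain \<xi> where \<xi>: "\<xi> \<in> carrier L" "\<xi> [^] (p ^ M) = \<zeta>"
    using exists_nth_root[OF K_closed[OF zK] pM] by blast
  have bnz: "b \<noteq> \<zero>" using b \<beta>(2) pM by (auto simp: nat_pow_zero)
  let ?q = "p ^ Suc M"
  note G = root_of_unity_gen_tower[OF g p \<xi>]
  have x1: "\<xi> [^] ?q = \<one>" using G unfolding root_of_unity_gen_def by blast
  \<comment> \<open>Choosing the exponents by \<open>SOME\<close> makes the numbers themselves, not
    just their residues, depend only on the images of \<open>b\<close> and \<open>\<xi>\<close>;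
    hence they are locally constant.\<close>
  define v where "v \<phi> = (SOME j::nat. \<phi> b = \<xi> [^] j \<otimes> b)" for \<phi> :: "'a \<Rightarrow> 'a"
  define u where "u \<phi> = (SOME j::nat. \<phi> \<xi> = \<xi> [^] j)" for \<phi> :: "'a \<Rightarrow> 'a"
  have u: "\<phi> \<xi> = \<xi> [^] u \<phi>" if \<phi>: "\<phi> \<in> gal L K" for \<phi>
  proof -
    have "(\<phi> \<xi>) [^] ?q = \<one>" using gal_pow[OF \<phi> \<xi>(1), of ?q] x1 \<phi> by simp
    then have "\<exists>j::nat. \<phi> \<xi> = \<xi> [^] j" using root_of_unity_gen_surj[OF G] \<phi> \<xi>(1) by simp
    then show ?thesis unfolding u_def by (rule someI_ex)
  qed
  have v: "\<phi> b = \<xi> [^] v \<phi> \<otimes> b" if \<phi>: "\<phi> \<in> gal L K" for \<phi>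
  proof -
    let ?k = "nat (\<alpha> \<phi> mod int p)"
    have "(\<phi> b) [^] ?q = b [^] ?q"
    proof -
      have "(\<phi> b) [^] ?q = ((\<phi> b) [^] (p ^ M)) [^] p"
        using \<phi> b(1) by (simp add: nat_pow_pow mult.commute)
      also have "(\<phi> b) [^] (p ^ M) = \<zeta> [^] ?k \<otimes> \<beta>" using gal_pow[OF \<phi> b(1), of "p ^ M"] b(2) act[OF \<phi>] by simp
      also have "(\<zeta> [^] ?k \<otimes> \<beta>) [^] p = (\<zeta> [^] p) [^] ?k \<otimes> \<beta> [^] p"
        using K_closed[OF zK] \<beta>(1) by (simp add: nat_pow_distrib nat_pow_pow mult.commute)
      also have "\<dots> = \<beta> [^] p" using g \<beta>(1) unfolding root_of_unity_gen_def by simp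
      also have "\<dots> = b [^] ?q" unfolding b(2)[symmetric] using b(1) by (simp add: nat_pow_pow mult.commute)
      finally show ?thesis .
    qed
    then have "\<exists>j::nat. \<phi> b = \<xi> [^] j \<otimes> b"
      using same_pow_imp_root_of_unity_mult[OF G _ b(1) bnz] \<phi> b(1) by simp
    then show ?thesis unfolding v_def by (rule someI_ex)
  qed
  show ?thesis
  proof (rule that[of "{b, \<xi>}" v u])
    show "finite {b, \<xi>}" "{b, \<xi>} \<subseteq> carrier L" using b \<xi> by auto
    show "v \<tau> = v \<phi> \<and> u \<tau> = u \<phi>" if "\<forall>x\<in>{b, \<xi>}. \<tau> x = \<phi> x" for \<phi> \<tau>
      using that unfolding v_def u_def by simp
    fix \<phi> assume \<phi>: "\<phi> \<in> gal L K"
    have xz: "(\<xi> [^] k) [^] (p ^ M) = \<zeta> [^] k" for k :: nat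
    proof -
      have "(\<xi> [^] k) [^] (p ^ M) = (\<xi> [^] (p ^ M)) [^] k" using \<xi>(1) by (simp add: nat_pow_pow mult.commute)
      then show ?thesis using \<xi>(2) by simp
    qed
    have "\<zeta> [^] u \<phi> = \<phi> (\<xi> [^] (p ^ M))" using gal_pow[OF \<phi> \<xi>(1), of "p ^ M"] u[OF \<phi>] xz by simp
    also have "\<dots> = \<zeta> [^] (1::nat)" using \<xi>(2) \<phi> zK K_closed[OF zK] by simp
    finally show "u \<phi> mod p = 1 mod p" unfolding root_of_unity_gen_pow_eq_iff[OF g] .
    have "\<zeta> [^] nat (\<alpha> \<phi> mod int p) \<otimes> \<beta> = (\<xi> [^] v \<phi> \<otimes> b) [^] (p ^ M)"
      using gal_pow[OF \<phi> b(1), of "p ^ M"] v[OF \<phi>] act[OF \<phi>] b(2) by simp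
    also have "\<dots> = \<zeta> [^] v \<phi> \<otimes> \<beta>" using \<xi>(1) b xz by (simp add: nat_pow_distrib)
    finally have "\<zeta> [^] nat (\<alpha> \<phi> mod int p) = \<zeta> [^] v \<phi>"
      using m_rcancel[OF \<beta>(2,1)] K_closed[OF zK] by simp
    then have "nat (\<alpha> \<phi> mod int p) mod p = v \<phi> mod p" unfolding root_of_unity_gen_pow_eq_iff[OF g] .
    then have "int (nat (\<alpha> \<phi> mod int p)) mod int p = int (v \<phi>) mod int p" by (metis zmod_int)
    then show "int (v \<phi>) mod int p = \<alpha> \<phi> mod int p" using prime_gt_0_nat[OF p] by simp
    fix \<tau> assume \<tau>: "\<tau> \<in> gal L K"
    note \<phi>\<tau> = gal_comp[OF \<phi> \<tau>]
    \<comment> \<open>Applying \<open>\<phi>\<close> to \<open>\<tau> b\<close> raises the factor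
      \<open>\<xi> [^] v \<tau>\<close> to the power \<open>u \<phi>\<close>; this is the
      composition law of affine maps.\<close>
    have "\<xi> [^] v (\<phi> \<circ> \<tau>) \<otimes> b = \<phi> (\<xi> [^] v \<tau> \<otimes> b)" using v[OF \<phi>\<tau>] v[OF \<tau>] by simp
    also have "\<dots> = (\<xi> [^] u \<phi>) [^] v \<tau> \<otimes> (\<xi> [^] v \<phi> \<otimes> b)" using \<phi> \<xi>(1) b(1) u[OF \<phi>] v[OF \<phi>] by simp
    also have "\<dots> = \<xi> [^] (v \<phi> + u \<phi> * v \<tau>) \<otimes> b"
      using \<xi>(1) b(1) by (simp add: nat_pow_pow nat_pow_mult m_assoc[symmetric] add.commute)
    finally have "\<xi> [^] v (\<phi> \<circ> \<tau>) = \<xi> [^] (v \<phi> + u \<phi> * v \<tau>)"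
      using m_rcancel[OF bnz b(1)] \<xi>(1) by simp
    then show "v (\<phi> \<circ> \<tau>) mod ?q = (v \<phi> + u \<phi> * v \<tau>) mod ?q" unfolding root_of_unity_gen_pow_eq_iff[OF G] .
    have "\<xi> [^] u (\<phi> \<circ> \<tau>) = \<phi> (\<xi> [^] u \<tau>)" using u[OF \<phi>\<tau>] u[OF \<tau>] by simp
    also have "\<dots> = \<xi> [^] (u \<phi> * u \<tau>)" using \<phi> \<xi>(1) u[OF \<phi>] by (simp add: nat_pow_pow)
    finally show "u (\<phi> \<circ> \<tau>) mod ?q = (u \<phi> * u \<tau>) mod ?q" unfolding root_of_unity_gen_pow_eq_iff[OF G] .
  qed
qed

end

section \<open>Unitriangular matrices from affine maps\<close>

unbundle fps_syntax

lemma one_plus_fps_X_power_nth: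
  "((1 + fps_X) ^ n :: 'a::comm_ring_1 fps) $ k = of_nat (n choose k)"
proof (induction n arbitrary: k)
  case (Suc n)
  show ?case
  proof (cases k)
    case (Suc j)
    have "((1 + fps_X) * (1 + fps_X) ^ n :: 'a fps) $ k = of_nat (n choose Suc j) + of_nat (n choose j)"
      unfolding fps_mult_fps_X_plus_1_nth by (simp add: Suc Suc.IH)
    then show ?thesis by (simp add: Suc)
  qed (simp add: fps_nth_power_0)
next
  case 0
  show ?case by (cases k) simp_all
qed

lemma one_plus_fps_X_power_nth_0 [simp]: "((1 + fps_X) ^ n :: int fps) $ 0 = 1"
  by (simp add: fps_nth_power_0)

text \<open>\<open>affine_mat v u l i\<close> is the coefficient of \<open>X^i\<close> in the image of \<open>X^l\<close> under the action
  \<open>f \<mapsto> (1 + X)^v f((1 + X)^u - 1)\<close> of the affine map \<open>x \<mapsto> u x + v\<close> on power series.\<close>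
definition affine_mat :: "nat \<Rightarrow> nat \<Rightarrow> nat \<Rightarrow> nat \<Rightarrow> int" where
  "affine_mat v u l i = ((1 + fps_X) ^ v * ((1 + fps_X) ^ u - 1) ^ l) $ i"

text \<open>Substituting (1 + X)^u - 1 for X in the series of \<open>v'\<close>, \<open>u'\<close>
  and multiplying by (1 + X)^v yields the series of the composite map. The coefficient of X^i is
  then a matrix product.\<close>

lemma affine_mat_comp:
  "affine_mat (v + u * v') (u * u') j i = (\<Sum>l\<le>i. affine_mat v u l i * affine_mat v' u' j l)"
proof -
  let ?g = "(1 + fps_X) ^ u - 1 :: int fps"
  let ?f = "(1 + fps_X) ^ v' * ((1 + fps_X) ^ u' - 1) ^ j :: int fps"
  have g0: "?g $ 0 = 0" by simp
  have "?f oo ?g = (1 + ?g) ^ v' * ((1 + ?g) ^ u' - 1) ^ j"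
    by (simp add: fps_compose_mult_distrib[OF g0] fps_compose_power[OF g0, symmetric] fps_compose_sub_distrib
        fps_compose_add_distrib)
  then have "(1 + fps_X) ^ (v + u * v') * ((1 + fps_X) ^ (u * u') - 1) ^ j = (1 + fps_X) ^ v * (?f oo ?g)"
    by (simp add: power_add power_mult mult.assoc)
  also have "\<dots> $ i = (\<Sum>k=0..i. ((1 + fps_X) ^ v) $ k * (\<Sum>l=0..i-k. ?f $ l * (?g ^ l) $ (i - k)))"
    by (simp only: fps_mult_nth fps_compose_nth)
  \<comment> \<open>The inner range is enlarged to one independent of \<open>k\<close>, so that the
    sums can be swapped; the added terms vanish because \<open>?g ^ l\<close> starts in degree
    \<open>l\<close>.\<close>
  also have "\<dots> = (\<Sum>k=0..i. ((1 + fps_X) ^ v) $ k * (\<Sum>l\<le>i. ?f $ l * (?g ^ l) $ (i - k)))"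
  proof (rule sum.cong[OF refl])
    fix k assume "k \<in> {0..i}"
    have "?f $ l * (?g ^ l) $ (i - k) = 0" if "l \<in> {..i} - {0..i-k}" for l
      using that startsby_zero_power_prefix[OF g0, of l] by auto
    then have "(\<Sum>l=0..i-k. ?f $ l * (?g ^ l) $ (i - k)) = (\<Sum>l\<le>i. ?f $ l * (?g ^ l) $ (i - k))"
      by (intro sum.mono_neutral_left) auto
    then show "((1 + fps_X) ^ v) $ k * (\<Sum>l=0..i-k. ?f $ l * (?g ^ l) $ (i - k)) =
        ((1 + fps_X) ^ v) $ k * (\<Sum>l\<le>i. ?f $ l * (?g ^ l) $ (i - k))" by (simp only:)
  qed
  also have "\<dots> = (\<Sum>l\<le>i. \<Sum>k=0..i. ?f $ l * (((1 + fps_X) ^ v) $ k * (?g ^ l) $ (i - k)))"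
    by (subst sum.swap) (simp add: sum_distrib_left mult_ac)
  also have "\<dots> = (\<Sum>l\<le>i. ?f $ l * ((1 + fps_X) ^ v * ?g ^ l) $ i)"
    by (simp add: fps_mult_nth sum_distrib_left)
  finally show ?thesis unfolding affine_mat_def by (simp add: mult.commute)
qed

lemma affine_mat_lower: "i < l \<Longrightarrow> affine_mat v u l i = 0"
  unfolding affine_mat_def fps_mult_nth
  by (intro sum.neutral) (auto simp: startsby_zero_power_prefix)

text \<open>(1 + X)^u - 1 has lowest term u X, and (1 + X)^v has constant term 1.\<close>

lemma affine_mat_diag: "affine_mat v u l l = int u ^ l"
proof -
  let ?g = "(1 + fps_X) ^ u - 1 :: int fps"
  have "affine_mat v u l l = (\<Sum>k=0..l. (1 + fps_X) ^ v $ k * (?g ^ l) $ (l - k))"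
    unfolding affine_mat_def fps_mult_nth by simp
  also have "\<dots> = (\<Sum>k\<in>{0}. (1 + fps_X) ^ v $ k * (?g ^ l) $ (l - k))"
    by (rule sum.mono_neutral_right) (auto simp: startsby_zero_power_prefix)
  also have "\<dots> = int u ^ l"
    using startsby_zero_power_nth_same[of ?g l] by (simp add: one_plus_fps_X_power_nth)
  finally show ?thesis .
qed

text \<open>The coefficient just past the lowest one has two sources: v u^l from the linear term of
  (1 + X)^v, and the second coefficient of ((1 + X)^u - 1)^l. The latter is controlled by
  \<open>u choose 2\<close>, which \<open>p\<close> divides since \<open>u\<close> is 1 modulo
  \<open>p\<close> and \<open>p\<close> is odd.\<close>

lemma affine_mat_subdiag:
  assumes "odd p" "u mod p = 1 mod p"
  shows "affine_mat v u l (Suc l) mod int p = int v mod int p"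
proof -
  let ?g = "(1 + fps_X) ^ u - 1 :: int fps"
  have g: "?g $ 0 = 0" "?g $ Suc 0 = int u" "?g $ 2 = int (u choose 2)"
    by (simp_all add: one_plus_fps_X_power_nth)
  have u1: "int p dvd int u - 1"
    using assms(2) by (metis mod_eq_dvd_iff of_nat_1 zmod_int)
  have c2: "int p dvd int (u choose 2)"
  proof -
    have "2 * int (u choose 2) = int u * (int u - 1)"
    proof (induction u)
      case (Suc u)
      have "Suc u choose 2 = u + (u choose 2)" by (simp add: numeral_2_eq_2)
      then show ?case using Suc by (simp add: algebra_simps)
    qed simp
    then have "int p dvd 2 * int (u choose 2)" using u1 by simp
    moreover have "coprime (int p) 2" using assms(1) by simp
    ultimately show ?thesis using coprime_dvd_mult_right_iff by blast
  qed
  have pow: "int p dvd (?g ^ l) $ Suc l" for l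
  proof (induction l)
    case (Suc l)
    have "(?g ^ Suc l) $ Suc (Suc l) = (\<Sum>k=0..Suc (Suc l). ?g $ k * (?g ^ l) $ (Suc (Suc l) - k))"
      by (simp only: power_Suc fps_mult_nth)
    also have "\<dots> = (\<Sum>k\<in>{1, 2}. ?g $ k * (?g ^ l) $ (Suc (Suc l) - k))"
    proof (rule sum.mono_neutral_right)
      show "\<forall>k\<in>{0..Suc (Suc l)} - {1, 2}. ?g $ k * (?g ^ l) $ (Suc (Suc l) - k) = 0"
      proof
        fix k assume k: "k \<in> {0..Suc (Suc l)} - {1, 2}"
        show "?g $ k * (?g ^ l) $ (Suc (Suc l) - k) = 0"
        proof (cases "k = 0")
          case True
          then show ?thesis using g by simp
        next
          case False
          then have "Suc (Suc l) - k < l" using k by auto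
          then show ?thesis using startsby_zero_power_prefix[OF g(1), of l] by simp
        qed
      qed
    qed auto
    also have "\<dots> = ?g $ 1 * (?g ^ l) $ Suc l + ?g $ 2 * (?g ^ l) $ l" by simp
    finally show ?case using Suc c2 unfolding g(3) by simp
  qed simp
  have "affine_mat v u l (Suc l) = (\<Sum>k=0..Suc l. (1 + fps_X) ^ v $ k * (?g ^ l) $ (Suc l - k))"
    unfolding affine_mat_def fps_mult_nth by simp
  also have "\<dots> = (\<Sum>k\<in>{0, 1}. (1 + fps_X) ^ v $ k * (?g ^ l) $ (Suc l - k))"
    by (rule sum.mono_neutral_right) (auto simp: startsby_zero_power_prefix)
  also have "\<dots> = (?g ^ l) $ Suc l + int v * int u ^ l"
    using startsby_zero_power_nth_same[OF g(1), of l] g(2) by (simp add: one_plus_fps_X_power_nth)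
  finally have "affine_mat v u l (Suc l) mod int p = (int v * int u ^ l) mod int p"
    using pow[of l] by (simp add: mod_eq_dvd_iff)
  moreover have "int u mod int p = 1 mod int p" using u1 by (simp add: mod_eq_dvd_iff)
  then have "int u ^ l mod int p = 1 mod int p" by (metis power_mod power_one)
  ultimately show ?thesis by (metis mod_mult_right_eq mult.right_neutral)
qed

section \<open>Congruences of truncated power series\<close>

text \<open>Equality of the images in the truncated ring (Z/p)[X]/(X^q).\<close>

definition fps_cong :: "int \<Rightarrow> nat \<Rightarrow> int fps \<Rightarrow> int fps \<Rightarrow> bool" where
  "fps_cong p q f g \<longleftrightarrow> (\<forall>i<q. p dvd (f - g) $ i)"

lemma fps_cong_refl [simp]: "fps_cong p q f f"
  unfolding fps_cong_def by simp

lemma fps_cong_trans: "fps_cong p q f g \<Longrightarrow> fps_cong p q g h \<Longrightarrow> fps_cong p q f h"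
  unfolding fps_cong_def by (metis (no_types, opaque_lifting) dvd_add fps_add_nth diff_add_cancel add_diff_eq)

lemma fps_cong_sym: "fps_cong p q f g \<Longrightarrow> fps_cong p q g f"
  unfolding fps_cong_def by (metis dvd_minus_iff fps_neg_nth minus_diff_eq)

lemma fps_cong_mult:
  assumes "fps_cong p q f g" "fps_cong p q h k"
  shows "fps_cong p q (f * h) (g * k)"
  unfolding fps_cong_def
proof (intro allI impI)
  fix i assume i: "i < q"
  have "f * h - g * k = (f - g) * h + (h - k) * g" by (simp add: algebra_simps)
  moreover have "p dvd ((f - g) * h) $ i" "p dvd ((h - k) * g) $ i"
    using assms i unfolding fps_cong_def fps_mult_nth by (auto intro!: dvd_sum dvd_mult2)
  ultimately show "p dvd (f * h - g * k) $ i" by (simp add: dvd_add)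
qed

lemma fps_cong_power: "fps_cong p q f g \<Longrightarrow> fps_cong p q (f ^ n) (g ^ n)"
  by (induct n) (auto intro: fps_cong_mult)

text \<open>For q = p^N the inner binomial coefficients of (1 + X)^q are divisible by
  \<open>p\<close> and X^q is truncated away, so (1 + X)^q counts as 1 and exponents matter only
  modulo q.\<close>

lemma fps_cong_one_plus_X_power_mod:
  assumes "prime p"
  shows "fps_cong (int p) (p ^ N) ((1 + fps_X) ^ v) ((1 + fps_X) ^ (v mod p ^ N))"
proof -
  let ?q = "p ^ N"
  have "fps_cong (int p) ?q ((1 + fps_X) ^ ?q) 1"
    unfolding fps_cong_def
  proof (intro allI impI)
    fix i assume i: "i < ?q"
    show "int p dvd ((1 + fps_X) ^ ?q - 1) $ i"
    proof (cases "i = 0")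
      case False
      \<comment> \<open>By i C(q, i) = q C(q-1, i-1): were C(q, i) prime to \<open>p\<close>, all of
        q would divide i, impossible for 0 < i < q.\<close>
      have "p dvd ?q choose i"
      proof (rule ccontr)
        assume "\<not> p dvd ?q choose i"
        then have "coprime ?q (?q choose i)"
          using assms by (simp add: prime_imp_coprime)
        moreover have "?q dvd i * (?q choose i)"
          using False by (subst times_binomial_minus1_eq) simp_all
        ultimately have "?q dvd i" using coprime_dvd_mult_left_iff by blast
        then show False using False i by (simp add: nat_dvd_not_less)
      qed
      then show ?thesis using False by (simp add: one_plus_fps_X_power_nth)
    qed (simp add: one_plus_fps_X_power_nth)
  qed
  then have "fps_cong (int p) ?q (((1 + fps_X) ^ ?q) ^ (v div ?q) * (1 + fps_X) ^ (v mod ?q))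
      (1 ^ (v div ?q) * (1 + fps_X) ^ (v mod ?q))"
    by (intro fps_cong_mult fps_cong_power) auto
  then show ?thesis by (simp flip: power_mult power_add)
qed

text \<open>The Galois action determines \<open>v\<close> and \<open>u\<close> only modulo a power
  of \<open>p\<close>; this makes the matrix entries modulo \<open>p\<close> well defined all the
  same.\<close>

lemma affine_mat_cong:
  assumes p: "prime p" and v: "v mod p ^ N = v' mod p ^ N" and u: "u mod p ^ N = u' mod p ^ N"
    and i: "i < p ^ N"
  shows "affine_mat v u l i mod int p = affine_mat v' u' l i mod int p"
proof -
  have c: "fps_cong (int p) (p ^ N) ((1 + fps_X) ^ a) ((1 + fps_X) ^ b)" if "a mod p ^ N = b mod p ^ N" for a b
    using fps_cong_one_plus_X_power_mod[OF p, of N a] fps_cong_one_plus_X_power_mod[OF p, of N b] that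
    by (metis fps_cong_sym fps_cong_trans)
  have "fps_cong (int p) (p ^ N) ((1 + fps_X) ^ u - 1) ((1 + fps_X) ^ u' - 1)"
    using c[OF u] unfolding fps_cong_def by simp
  then have "fps_cong (int p) (p ^ N) ((1 + fps_X) ^ v * ((1 + fps_X) ^ u - 1) ^ l)
      ((1 + fps_X) ^ v' * ((1 + fps_X) ^ u' - 1) ^ l)"
    by (intro fps_cong_mult fps_cong_power c[OF v])
  then show ?thesis using i unfolding fps_cong_def affine_mat_def by (simp add: mod_eq_dvd_iff)
qed

text \<open>Reversing the indices makes the matrices upper triangular; with \<open>u\<close> congruent to 1 they are
  unitriangular modulo \<open>p\<close>.\<close>
lemma affine_mat_unitriangular_comp:
  assumes p: "prime p" and i: "i < j" "j \<le> n" "n < p ^ N"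
    and u: "u mod p = 1 mod p" "u' mod p = 1 mod p"
    and v'': "v'' mod p ^ N = (v + u * v') mod p ^ N" and u'': "u'' mod p ^ N = (u * u') mod p ^ N"
  shows "affine_mat v'' u'' (n - j) (n - i) mod int p =
    (affine_mat v u (n - j) (n - i) + affine_mat v' u' (n - j) (n - i) +
     (\<Sum>l\<in>{i<..<j}. affine_mat v u (n - l) (n - i) * affine_mat v' u' (n - j) (n - l))) mod int p"
proof -
  let ?A = "affine_mat v u" and ?B = "affine_mat v' u'"
  have diag: "affine_mat v u l l mod int p = 1 mod int p" if "u mod p = 1 mod p" for v u l
    unfolding affine_mat_diag using that by (metis of_nat_1 power_mod power_one zmod_int)
  have "affine_mat v'' u'' (n - j) (n - i) mod int p = affine_mat (v + u * v') (u * u') (n - j) (n - i) mod int p"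
    using i by (intro affine_mat_cong[OF p v'' u'']) simp
  also have "affine_mat (v + u * v') (u * u') (n - j) (n - i) = (\<Sum>l\<le>n - i. ?A l (n - i) * ?B (n - j) l)"
    by (rule affine_mat_comp)
  \<comment> \<open>The terms with \<open>l < n - j\<close> vanish by triangularity; afterwards
    \<open>l\<close> is replaced by \<open>n - l\<close>.\<close>
  also have "\<dots> = (\<Sum>l\<in>{n - j..n - i}. ?A l (n - i) * ?B (n - j) l)"
    by (rule sum.mono_neutral_right) (auto simp: affine_mat_lower)
  also have "\<dots> = (\<Sum>l\<in>{i..j}. ?A (n - l) (n - i) * ?B (n - j) (n - l))"
    by (rule sum.reindex_bij_witness[of _ "\<lambda>l. n - l" "\<lambda>l. n - l"]) (use i in auto)
  \<comment> \<open>The two end terms contain a diagonal entry, which is 1 modulo \<open>p\<close>;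
    they become the two linear terms of the law.\<close>
  also have "{i..j} = insert i (insert j {i<..<j})" using i by auto
  also have "(\<Sum>l\<in>insert i (insert j {i<..<j}). ?A (n - l) (n - i) * ?B (n - j) (n - l)) =
     ?A (n - i) (n - i) * ?B (n - j) (n - i) + (?A (n - j) (n - i) * ?B (n - j) (n - j) +
     (\<Sum>l\<in>{i<..<j}. ?A (n - l) (n - i) * ?B (n - j) (n - l)))"
    using i by (subst sum.insert; simp)+
  also have "\<dots> mod int p = (1 * ?B (n - j) (n - i) + (?A (n - j) (n - i) * 1 +
     (\<Sum>l\<in>{i<..<j}. ?A (n - l) (n - i) * ?B (n - j) (n - l)))) mod int p"
    using diag[OF u(1), of v "n - i"] diag[OF u(2), of v' "n - j"] by (intro mod_add_cong mod_mult_cong refl)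
  finally show ?thesis by (simp add: add_ac)
qed

unbundle no fps_syntax

section \<open>Massey products\<close>

context algebraic_closure
begin

text \<open>The matrices with entries \<open>a i j\<close> are multiplicative, so \<open>- a\<close> rather than \<open>a\<close> satisfies the
  equations of a defining system.\<close>
lemma kummer_char_unipotent:
  assumes prim: "primitive_root L K p \<zeta>" and p: "prime p" "odd p"
    and b: "b \<noteq> \<zero>" and kum: "kummer_char L K p \<zeta> b \<alpha>"
  obtains a :: "nat \<Rightarrow> nat \<Rightarrow> ('a \<Rightarrow> 'a) \<Rightarrow> int" where
    "\<And>i j. cont1 L K p (a i j)"
    "\<And>i \<phi>. i < n \<Longrightarrow> \<phi> \<in> gal L K \<Longrightarrow> a i (Suc i) \<phi> mod int p = \<alpha> \<phi> mod int p"
    "\<And>i j \<phi> \<tau>. i < j \<Longrightarrow> j \<le> n \<Longrightarrow> \<phi> \<in> gal L K \<Longrightarrow> \<tau> \<in> gal L K \<Longrightarrow>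
       a i j (\<phi> \<circ> \<tau>) mod int p =
       (a i j \<phi> + a i j \<tau> + (\<Sum>l\<in>{i<..<j}. a i l \<phi> * a l j \<tau>)) mod int p"
proof -
  obtain \<beta> where \<beta>: "\<beta> \<in> carrier L" "\<beta> [^] p = b"
    and act: "\<And>\<phi>. \<phi> \<in> gal L K \<Longrightarrow> \<phi> \<beta> = \<zeta> [^] nat (\<alpha> \<phi> mod int p) \<otimes> \<beta>"
    using kum unfolding kummer_char_def by blast
  have \<beta>0: "\<beta> \<noteq> \<zero>" using \<beta>(2) b prime_gt_0_nat[OF p(1)] by (auto simp: nat_pow_zero)
  have zK: "\<zeta> \<in> K" using prim unfolding primitive_root_def by blast
  obtain v u :: "('a \<Rightarrow> 'a) \<Rightarrow> nat" and S where S: "finite S" "S \<subseteq> carrier L"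
    and loc: "\<And>\<phi> \<tau>. \<forall>x\<in>S. \<tau> x = \<phi> x \<Longrightarrow> v \<tau> = v \<phi> \<and> u \<tau> = u \<phi>"
    and u1: "\<And>\<phi>. \<phi> \<in> gal L K \<Longrightarrow> u \<phi> mod p = 1 mod p"
    and v\<alpha>: "\<And>\<phi>. \<phi> \<in> gal L K \<Longrightarrow> int (v \<phi>) mod int p = \<alpha> \<phi> mod int p"
    and vc: "\<And>\<phi> \<tau>. \<phi> \<in> gal L K \<Longrightarrow> \<tau> \<in> gal L K \<Longrightarrow> v (\<phi> \<circ> \<tau>) mod p ^ Suc n = (v \<phi> + u \<phi> * v \<tau>) mod p ^ Suc n"
    and uc: "\<And>\<phi> \<tau>. \<phi> \<in> gal L K \<Longrightarrow> \<tau> \<in> gal L K \<Longrightarrow> u (\<phi> \<circ> \<tau>) mod p ^ Suc n = (u \<phi> * u \<tau>) mod p ^ Suc n"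
    by (rule kummer_tower[where M=n and \<alpha>=\<alpha>, OF primitive_root_imp_gen[OF prim p(1)] zK p(1) \<beta>(1) \<beta>0])
      (erule act, (rule that; assumption))
  define a where "a i j \<phi> = affine_mat (v \<phi>) (u \<phi>) (n - j) (n - i)" for i j \<phi>
  \<comment> \<open>The modulus chosen for the tower exceeds \<open>n\<close>, so truncation at that
    degree keeps every matrix entry in use.\<close>
  have n: "n < p ^ Suc n" using power_gt_expt[of p "Suc n"] prime_gt_1_nat[OF p(1)] by simp
  show ?thesis
  proof (rule that[of a])
    show "cont1 L K p (a i j)" for i j
      unfolding cont1_def
    proof
      fix \<phi> assume "\<phi> \<in> gal L K"
      show "\<exists>S. finite S \<and> S \<subseteq> carrier L \<and>
          (\<forall>\<tau>\<in>gal L K. (\<forall>x\<in>S. \<tau> x = \<phi> x) \<longrightarrow> a i j \<tau> mod int p = a i j \<phi> mod int p)"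
        using S loc unfolding a_def by (intro exI[of _ S]) metis
    qed
    show "a i (Suc i) \<phi> mod int p = \<alpha> \<phi> mod int p" if "i < n" "\<phi> \<in> gal L K" for i \<phi>
    proof -
      have "n - i = Suc (n - Suc i)" using that by simp
      then show ?thesis using affine_mat_subdiag[OF p(2) u1[OF that(2)]] v\<alpha>[OF that(2)] unfolding a_def by simp
    qed
    show "a i j (\<phi> \<circ> \<tau>) mod int p =
       (a i j \<phi> + a i j \<tau> + (\<Sum>l\<in>{i<..<j}. a i l \<phi> * a l j \<tau>)) mod int p"
      if "i < j" "j \<le> n" "\<phi> \<in> gal L K" "\<tau> \<in> gal L K" for i j \<phi> \<tau>
      unfolding a_def
      by (rule affine_mat_unitriangular_comp[OF p(1) that(1,2) n u1[OF that(3)] u1[OF that(4)] vc uc])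
        (use that in auto)
  qed
qed

text \<open>As \<open>\<chi>\<close> is nonzero, \<open>a\<close> is no \<open>p\<close>-th power,
  so rigidity gives b = a^i c^p. Then \<open>y\<close> equals x^i c up to a root of unity in
  \<open>K\<close>, and comparing Galois actions gives \<open>i\<close> as the multiplier.\<close>

lemma rigid_cup_zero_multiple:
  assumes prim: "primitive_root L K p \<zeta>" and p: "prime p" and rigid: "p_rigid L K p \<zeta>"
    and a: "a \<in> K - {\<zero>}" "kummer_char L K p \<zeta> a \<chi>"
    and b: "b \<in> K - {\<zero>}" "kummer_char L K p \<zeta> b \<psi>"
    and cup: "coboundary2 L K p (\<lambda>\<phi> \<tau>. \<chi> \<phi> * \<psi> \<tau>)"
    and nz: "\<phi>\<^sub>0 \<in> gal L K" "\<chi> \<phi>\<^sub>0 mod int p \<noteq> 0"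
  shows "\<exists>k::int. \<forall>\<phi>\<in>gal L K. \<psi> \<phi> mod int p = (k * \<chi> \<phi>) mod int p"
proof -
  note G = primitive_root_imp_gen[OF prim p]
  have p0: "p > 0" using prime_gt_0_nat[OF p] .
  have zK: "\<zeta> \<in> K" and z: "\<zeta> \<in> carrier L" "\<zeta> [^] p = \<one>" using prim unfolding primitive_root_def by auto
  obtain x where x: "x \<in> carrier L" "x [^] p = a"
    and xact: "\<And>\<phi>. \<phi> \<in> gal L K \<Longrightarrow> \<phi> x = \<zeta> [^] nat (\<chi> \<phi> mod int p) \<otimes> x"
    using a(2) unfolding kummer_char_def by blast
  obtain y where y: "y \<in> carrier L" "y [^] p = b"
    and yact: "\<And>\<phi>. \<phi> \<in> gal L K \<Longrightarrow> \<phi> y = \<zeta> [^] nat (\<psi> \<phi> mod int p) \<otimes> y"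
    using b(2) unfolding kummer_char_def by blast
  have xnz: "x \<noteq> \<zero>" using x a p0 by (auto simp: nat_pow_zero)
  have ynz: "y \<noteq> \<zero>" using y b p0 by (auto simp: nat_pow_zero)
  \<comment> \<open>If a = c^p, then \<open>x\<close> is a root of unity in \<open>K\<close> times
    \<open>c\<close>, hence fixed by the Galois group, which would make \<open>\<chi>\<close>
    trivial.\<close>
  have "\<not> pth_power L K p a"
  proof
    assume "pth_power L K p a"
    then obtain c where c: "c \<in> K" "a = c [^] p" unfolding pth_power_def by blast
    have cnz: "c \<noteq> \<zero>" using c a p0 by (auto simp: nat_pow_zero)
    obtain j :: nat where "x = \<zeta> [^] j \<otimes> c"
      using same_pow_imp_root_of_unity_mult[OF G x(1) K_closed[OF c(1)] cnz] x(2) c(2) by blast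
    then have "x \<in> K" using zK c(1) subringE(6)[OF subfieldE(1)[OF subfield_axioms]] by simp
    then have "\<zeta> [^] nat (\<chi> \<phi>\<^sub>0 mod int p) \<otimes> x = \<one> \<otimes> x" using xact[OF nz(1)] nz(1) x(1) by simp
    then have "\<zeta> [^] nat (\<chi> \<phi>\<^sub>0 mod int p) = \<zeta> [^] (0::nat)" using m_rcancel[OF xnz x(1)] z by simp
    then have "nat (\<chi> \<phi>\<^sub>0 mod int p) mod p = 0" unfolding root_of_unity_gen_pow_eq_iff[OF G] by simp
    then show False using nz(2) p0 by (metis mod_mod_trivial nat_mod_distrib nat_int of_nat_0_le_iff
          pos_mod_sign of_nat_0_less_iff nat_0_iff order_antisym)
  qed
  then have "p_rigid_elem L K p \<zeta> a" using rigid a(1) unfolding p_rigid_def by simp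
  from this[unfolded p_rigid_elem_def, rule_format, OF b(1) conjI[OF a(2) conjI[OF b(2) cup]]]
  obtain i :: nat and c where c: "c \<in> K - {\<zero>}" "b = (a [^] i) \<otimes> (c [^] p)" by blast
  have cc: "c \<in> carrier L" "c \<noteq> \<zero>" using c by auto
  have "(x [^] i) [^] p = (x [^] p) [^] i" using x(1) by (simp add: nat_pow_pow mult.commute)
  then have "y [^] p = (x [^] i \<otimes> c) [^] p"
    using y(2) c(2) x cc by (simp add: nat_pow_distrib)
  moreover have "x [^] i \<otimes> c \<noteq> \<zero>" using nat_pow_nonzero[OF x(1) xnz] x cc by (simp add: integral_iff)
  ultimately obtain j :: nat where j: "y = \<zeta> [^] j \<otimes> (x [^] i \<otimes> c)"
    using same_pow_imp_root_of_unity_mult[OF G y(1), of "x [^] i \<otimes> c"] x cc by blast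
  have "\<psi> \<phi> mod int p = (int i * \<chi> \<phi>) mod int p" if \<phi>: "\<phi> \<in> gal L K" for \<phi>
  proof -
    let ?k = "nat (\<chi> \<phi> mod int p)" and ?l = "nat (\<psi> \<phi> mod int p)"
    have "\<phi> y = \<zeta> [^] j \<otimes> ((\<zeta> [^] ?k \<otimes> x) [^] i \<otimes> c)"
      unfolding j using \<phi> z zK x cc c(1) gal_pow[OF \<phi> x(1), of i] xact[OF \<phi>] by simp
    also have "\<dots> = \<zeta> [^] (?k * i) \<otimes> y"
      unfolding j using z x cc by (simp add: nat_pow_distrib nat_pow_pow m_ac)
    finally have "\<zeta> [^] ?l = \<zeta> [^] (?k * i)"
      using yact[OF \<phi>] m_rcancel[OF ynz y(1)] z by simp
    then have "?l mod p = (?k * i) mod p" unfolding root_of_unity_gen_pow_eq_iff[OF G] .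
    then have "int ?l mod int p = (int ?k * int i) mod int p" by (metis zmod_int of_nat_mult)
    then show ?thesis using p0 by (simp add: mod_mult_right_eq mult.commute)
  qed
  then show ?thesis by blast
qed

text \<open>The indices where \<open>\<alpha> i\<close> is nonzero fall into blocks on which all characters are multiples of
  the first one, \<open>\<alpha> (s i)\<close>; a new block can only begin after a zero character.\<close>
lemma proportional_blocks:
  assumes "\<And>i. 1 \<le> i \<Longrightarrow> i < n \<Longrightarrow> \<not> (\<forall>\<phi>\<in>gal L K. \<alpha> i \<phi> mod int p = 0) \<Longrightarrow>
      \<exists>k::int. \<forall>\<phi>\<in>gal L K. \<alpha> (Suc i) \<phi> mod int p = (k * \<alpha> i \<phi>) mod int p"
  obtains s :: "nat \<Rightarrow> nat" and m :: "nat \<Rightarrow> int" where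
    "\<And>i. 1 \<le> i \<Longrightarrow> i \<le> n \<Longrightarrow> 1 \<le> s i \<and> s i \<le> n"
    "\<And>i \<phi>. 1 \<le> i \<Longrightarrow> i \<le> n \<Longrightarrow> \<phi> \<in> gal L K \<Longrightarrow> \<alpha> i \<phi> mod int p = (m i * \<alpha> (s i) \<phi>) mod int p"
    "\<And>i. 1 \<le> i \<Longrightarrow> m i \<noteq> 0 \<Longrightarrow> s (Suc i) = s i"
proof -
  define Z where "Z i \<longleftrightarrow> (\<forall>\<phi>\<in>gal L K. \<alpha> i \<phi> mod int p = 0)" for i
  \<comment> \<open>The value at 0 is a dummy; the case \<open>i = 0\<close> opens the first block
    at index 1.\<close>
  define s where "s = rec_nat 0 (\<lambda>i r. if i = 0 \<or> Z i then Suc i else r)"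
  have s_Suc: "s (Suc i) = (if i = 0 \<or> Z i then Suc i else s i)" for i unfolding s_def by simp
  have ex: "1 \<le> s i \<and> s i \<le> i \<and> (\<exists>k::int. \<forall>\<phi>\<in>gal L K. \<alpha> i \<phi> mod int p = (k * \<alpha> (s i) \<phi>) mod int p)"
    if "1 \<le> i" "i \<le> n" for i
    using that
  proof (induction i)
    case (Suc i)
    have triv: "\<exists>k::int. \<forall>\<phi>\<in>gal L K. \<alpha> (Suc i) \<phi> mod int p = (k * \<alpha> (Suc i) \<phi>) mod int p"
      by (rule exI[of _ 1]) simp
    show ?case
    proof (cases "i = 0 \<or> Z i")
      case True
      then show ?thesis using triv by (simp add: s_Suc)
    next
      case False
      then have i: "1 \<le> i" "i < n" using Suc.prems by auto
      obtain k1 :: int where k1: "\<forall>\<phi>\<in>gal L K. \<alpha> i \<phi> mod int p = (k1 * \<alpha> (s i) \<phi>) mod int p"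
        and si: "1 \<le> s i" "s i \<le> i" using Suc.IH i by auto
      obtain k2 :: int where k2: "\<forall>\<phi>\<in>gal L K. \<alpha> (Suc i) \<phi> mod int p = (k2 * \<alpha> i \<phi>) mod int p"
        using assms[OF i] False unfolding Z_def by blast
      have "\<alpha> (Suc i) \<phi> mod int p = ((k2 * k1) * \<alpha> (s i) \<phi>) mod int p" if "\<phi> \<in> gal L K" for \<phi>
        using k1 k2 that by (metis mod_mult_right_eq mult.assoc)
      then show ?thesis using False si by (auto simp: s_Suc)
    qed
  qed simp
  \<comment> \<open>The multiplier is forced to 0 at zero characters, so that a nonzero multiplier
    certifies that the block continues.\<close>
  define m where "m i = (if Z i then 0 else
      (SOME k::int. \<forall>\<phi>\<in>gal L K. \<alpha> i \<phi> mod int p = (k * \<alpha> (s i) \<phi>) mod int p))" for i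
  show ?thesis
  proof (rule that[of s m])
    show "1 \<le> s i \<and> s i \<le> n" if "1 \<le> i" "i \<le> n" for i using ex[OF that] that by auto
    show "\<alpha> i \<phi> mod int p = (m i * \<alpha> (s i) \<phi>) mod int p" if "1 \<le> i" "i \<le> n" "\<phi> \<in> gal L K" for i \<phi>
    proof (cases "Z i")
      case True
      then show ?thesis using that unfolding m_def Z_def by simp
    next
      case False
      have "\<exists>k::int. \<forall>\<phi>\<in>gal L K. \<alpha> i \<phi> mod int p = (k * \<alpha> (s i) \<phi>) mod int p"
        using ex[OF that(1,2)] by blast
      from someI_ex[OF this] have "\<forall>\<phi>\<in>gal L K. \<alpha> i \<phi> mod int p = (m i * \<alpha> (s i) \<phi>) mod int p"
        unfolding m_def if_not_P[OF False] .
      then show ?thesis using that(3) by blast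
    qed
    show "s (Suc i) = s i" if "1 \<le> i" "m i \<noteq> 0" for i
      using that unfolding m_def by (auto simp: s_Suc split: if_splits)
  qed
qed

text \<open>The given defining system yields the vanishing of consecutive cup products. A new system
  is then built that extends to the omitted corner entry, and this entry bounds its value.\<close>

lemma massey_contains_zero_rigid:
  assumes n: "n \<ge> 3" and p: "prime p" "odd p" and prim: "primitive_root L K p \<zeta>"
    and rigid: "p_rigid L K p \<zeta>"
    and coc: "\<And>i. 1 \<le> i \<Longrightarrow> i \<le> n \<Longrightarrow> cocycle1 L K p (\<alpha> i)"
    and dfd: "massey_defined L K p n \<alpha>"
  shows "massey_contains_zero L K p n \<alpha>"
proof -
  have kum: "\<exists>b. b \<in> K - {\<zero>} \<and> kummer_char L K p \<zeta> b (\<alpha> i)" if "1 \<le> i" "i \<le> n" for i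
    by (rule cocycle_is_kummer[OF prim p(1) coc[OF that]]) blast
  obtain A where A: "defining_system L K p n \<alpha> A" using dfd unfolding massey_defined_def by blast
  note A = A[unfolded defining_system_def]
  note A1 = conjunct1[OF A, rule_format] and A2 = conjunct1[OF conjunct2[OF A], rule_format]
    and A3 = conjunct2[OF conjunct2[OF A], rule_format]
  \<comment> \<open>The entry \<open>A i (i + 2)\<close> bounds the cup product of neighbours;
    \<open>n \<ge> 3\<close> keeps its position away from the excluded corner.\<close>
  have step: "\<exists>k::int. \<forall>\<phi>\<in>gal L K. \<alpha> (Suc i) \<phi> mod int p = (k * \<alpha> i \<phi>) mod int p"
    if i: "1 \<le> i" "i < n" and nz: "\<not> (\<forall>\<phi>\<in>gal L K. \<alpha> i \<phi> mod int p = 0)" for i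
  proof -
    have c: "cont1 L K p (A i (i + 2))" using A1[of i "i + 2"] n i by auto
    have s: "A i (Suc i) \<phi> mod int p = \<alpha> i \<phi> mod int p" "A (Suc i) (Suc (Suc i)) \<phi> mod int p = \<alpha> (Suc i) \<phi> mod int p"
      if "\<phi> \<in> gal L K" for \<phi> using A2[of i \<phi>] A2[of "Suc i" \<phi>] i that by auto
    have "(\<alpha> i \<phi> * \<alpha> (Suc i) \<tau>) mod int p =
        (A i (i + 2) \<tau> - A i (i + 2) (\<phi> \<circ> \<tau>) + A i (i + 2) \<phi>) mod int p"
      if "\<phi> \<in> gal L K" "\<tau> \<in> gal L K" for \<phi> \<tau>
    proof -
      have "(A i (i + 2) \<tau> - A i (i + 2) (\<phi> \<circ> \<tau>) + A i (i + 2) \<phi>) mod int p =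
          (\<Sum>l\<in>{i + 1..i + 2 - 1}. A i l \<phi> * A l (i + 2) \<tau>) mod int p"
        using A3[of i "i + 2" \<phi> \<tau>] n i that by auto
      also have "\<dots> = (A i (Suc i) \<phi> * A (Suc i) (Suc (Suc i)) \<tau>) mod int p" by simp
      also have "\<dots> = (\<alpha> i \<phi> * \<alpha> (Suc i) \<tau>) mod int p" using s that by (intro mod_mult_cong) auto
      finally show ?thesis by simp
    qed
    then have "coboundary2 L K p (\<lambda>\<phi> \<tau>. \<alpha> i \<phi> * \<alpha> (Suc i) \<tau>)"
      using c unfolding coboundary2_def by blast
    moreover obtain a where "a \<in> K - {\<zero>}" "kummer_char L K p \<zeta> a (\<alpha> i)" using kum[of i] i by auto
    moreover obtain b where "b \<in> K - {\<zero>}" "kummer_char L K p \<zeta> b (\<alpha> (Suc i))" using kum[of "Suc i"] i by auto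
    moreover obtain \<phi>\<^sub>0 where "\<phi>\<^sub>0 \<in> gal L K" "\<alpha> i \<phi>\<^sub>0 mod int p \<noteq> 0" using nz by blast
    ultimately show ?thesis by (intro rigid_cup_zero_multiple[OF prim p(1) rigid])
  qed
  obtain s :: "nat \<Rightarrow> nat" and m :: "nat \<Rightarrow> int" where
    s: "\<And>i. 1 \<le> i \<Longrightarrow> i \<le> n \<Longrightarrow> 1 \<le> s i \<and> s i \<le> n"
    and m: "\<And>i \<phi>. 1 \<le> i \<Longrightarrow> i \<le> n \<Longrightarrow> \<phi> \<in> gal L K \<Longrightarrow> \<alpha> i \<phi> mod int p = (m i * \<alpha> (s i) \<phi>) mod int p"
    and sm: "\<And>i. 1 \<le> i \<Longrightarrow> m i \<noteq> 0 \<Longrightarrow> s (Suc i) = s i"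
    using proportional_blocks[of n \<alpha> p, OF step] by blast
  define unip where "unip r a \<longleftrightarrow> (\<forall>i j. cont1 L K p (a i j)) \<and>
      (\<forall>i \<phi>. i \<le> n \<longrightarrow> \<phi> \<in> gal L K \<longrightarrow> a i (Suc i) \<phi> mod int p = \<alpha> r \<phi> mod int p) \<and>
      (\<forall>i j \<phi> \<tau>. i < j \<longrightarrow> j \<le> n + 1 \<longrightarrow> \<phi> \<in> gal L K \<longrightarrow> \<tau> \<in> gal L K \<longrightarrow>
         a i j (\<phi> \<circ> \<tau>) mod int p =
         (a i j \<phi> + a i j \<tau> + (\<Sum>l\<in>{i<..<j}. a i l \<phi> * a l j \<tau>)) mod int p)" for r a
  \<comment> \<open>One lift is fixed per leading character, so indices with the same leader
    \<open>s i\<close> share the same matrices.\<close>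
  define B where "B r = (SOME a. unip r a)" for r
  have ex: "\<exists>a. unip r a" if r: "1 \<le> r" "r \<le> n" for r
  proof -
    obtain b where b: "b \<in> K - {\<zero>}" "kummer_char L K p \<zeta> b (\<alpha> r)" using kum[OF r] by blast
    then have bnz: "b \<noteq> \<zero>" by blast
    show ?thesis
    proof (rule kummer_char_unipotent[OF prim p bnz b(2), of "n + 1"])
      fix a :: "nat \<Rightarrow> nat \<Rightarrow> ('a \<Rightarrow> 'a) \<Rightarrow> int"
      assume 1: "\<And>i j. cont1 L K p (a i j)"
        and 2: "\<And>i \<phi>. i < n + 1 \<Longrightarrow> \<phi> \<in> gal L K \<Longrightarrow> a i (Suc i) \<phi> mod int p = \<alpha> r \<phi> mod int p"
        and 3: "\<And>i j \<phi> \<tau>. i < j \<Longrightarrow> j \<le> n + 1 \<Longrightarrow> \<phi> \<in> gal L K \<Longrightarrow> \<tau> \<in> gal L K \<Longrightarrow>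
          a i j (\<phi> \<circ> \<tau>) mod int p =
          (a i j \<phi> + a i j \<tau> + (\<Sum>l\<in>{i<..<j}. a i l \<phi> * a l j \<tau>)) mod int p"
      show ?thesis
        unfolding unip_def
        by (intro exI[of _ a] conjI allI impI) (rule 1, rule 2, simp, assumption, rule 3, assumption+)
    qed
  qed
  have "unip r (B r)" if "1 \<le> r" "r \<le> n" for r
    unfolding B_def by (rule someI_ex[OF ex[OF that]])
  note B = this[unfolded unip_def]
  note Bc = conjunct1[OF B, rule_format] and B1 = conjunct1[OF conjunct2[OF B], rule_format]
    and Bm = conjunct2[OF conjunct2[OF B], rule_format]
  \<comment> \<open>Up to sign this is conjugation by a diagonal matrix, written with products so
    that zero multipliers are allowed. The sign on \<open>m l\<close> cancels the overall sign of
    \<open>a\<close> on the superdiagonal.\<close>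
  define P where "P i j = (\<Prod>l\<in>{i..<j}. - m l)" for i j
  define a where "a i j \<phi> = - (P i j * B (s i) i j \<phi>)" for i j \<phi>
  have cont: "cont1 L K p (a i j)" if i: "1 \<le> i" "i \<le> n" for i j
    unfolding cont1_def
  proof
    fix \<phi> assume \<phi>: "\<phi> \<in> gal L K"
    have "cont1 L K p (B (s i) i j)" using Bc[of "s i" i j] s[OF i] by simp
    from bspec[OF this[unfolded cont1_def] \<phi>]
    obtain S where S: "finite S \<and> S \<subseteq> carrier L \<and> (\<forall>\<tau>\<in>gal L K. (\<forall>x\<in>S. \<tau> x = \<phi> x) \<longrightarrow>
        B (s i) i j \<tau> mod int p = B (s i) i j \<phi> mod int p)" by (elim exE)
    have "a i j \<tau> mod int p = a i j \<phi> mod int p" if "\<tau> \<in> gal L K" "\<forall>x\<in>S. \<tau> x = \<phi> x" for \<tau>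
      unfolding a_def by (intro mod_minus_cong mod_mult_cong refl) (use S that in simp)
    then show "\<exists>S. finite S \<and> S \<subseteq> carrier L \<and>
        (\<forall>\<tau>\<in>gal L K. (\<forall>x\<in>S. \<tau> x = \<phi> x) \<longrightarrow> a i j \<tau> mod int p = a i j \<phi> mod int p)"
      using S by (intro exI[of _ S]) simp
  qed
  have law: "(a i j \<tau> - a i j (\<phi> \<circ> \<tau>) + a i j \<phi>) mod int p = (\<Sum>l\<in>{i + 1..j - 1}. a i l \<phi> * a l j \<tau>) mod int p"
    if ij: "1 \<le> i" "i < j" "j \<le> n + 1" and \<phi>: "\<phi> \<in> gal L K" and \<tau>: "\<tau> \<in> gal L K" for i j \<phi> \<tau>
  proof -
    have si: "1 \<le> s i" "s i \<le> n" using s[of i] ij by auto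
    let ?b = "B (s i)"
    \<comment> \<open>If \<open>P i l\<close> is nonzero, no multiplier from \<open>i\<close> up to
      \<open>l\<close> vanishes, so \<open>l\<close> has the leader of \<open>i\<close> and both
      factors come from one lift. Otherwise both sides are 0.\<close>
    have summand: "P i j * (?b i l \<phi> * ?b l j \<tau>) = a i l \<phi> * a l j \<tau>" if l: "l \<in> {i<..<j}" for l
    proof -
      have split: "P i j = P i l * P l j"
        unfolding P_def using l by (subst prod.atLeastLessThan_concat) auto
      show ?thesis
      proof (cases "P i l = 0")
        case True
        then show ?thesis unfolding a_def split by simp
      next
        case False
        then have mnz: "m k \<noteq> 0" if "k \<in> {i..<l}" for k using that unfolding P_def by auto
        have "s (i + d) = s i" if "i + d \<le> l" for d
          using that
        proof (induction d)
          case (Suc d)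
          then show ?case using sm[of "i + d"] mnz[of "i + d"] ij by auto
        qed simp
        from this[of "l - i"] have "s l = s i" using l by simp
        then show ?thesis unfolding a_def split by simp
      qed
    qed
    have "(a i j \<tau> - a i j (\<phi> \<circ> \<tau>) + a i j \<phi>) = P i j * (?b i j (\<phi> \<circ> \<tau>) - (?b i j \<phi> + ?b i j \<tau>))"
      unfolding a_def by (simp add: algebra_simps)
    also have "\<dots> mod int p = (P i j * (\<Sum>l\<in>{i<..<j}. ?b i l \<phi> * ?b l j \<tau>)) mod int p"
    proof (rule mod_mult_cong[OF refl])
      show "(?b i j (\<phi> \<circ> \<tau>) - (?b i j \<phi> + ?b i j \<tau>)) mod int p = (\<Sum>l\<in>{i<..<j}. ?b i l \<phi> * ?b l j \<tau>) mod int p"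
        using Bm[OF si ij(2,3) \<phi> \<tau>] by (simp add: mod_eq_dvd_iff algebra_simps)
    qed
    also have "P i j * (\<Sum>l\<in>{i<..<j}. ?b i l \<phi> * ?b l j \<tau>) = (\<Sum>l\<in>{i<..<j}. a i l \<phi> * a l j \<tau>)"
      unfolding sum_distrib_left by (rule sum.cong[OF refl summand])
    also have "{i<..<j} = {i + 1..j - 1}" using ij by auto
    finally show ?thesis .
  qed
  have "defining_system L K p n \<alpha> a"
    unfolding defining_system_def
  proof (intro conjI allI impI ballI)
    fix i j assume "1 \<le> i \<and> i < j \<and> j \<le> n + 1 \<and> (i, j) \<noteq> (1, n + 1)"
    then show "cont1 L K p (a i j)" using cont by auto
  next
    fix i \<phi> assume i: "1 \<le> i \<and> i \<le> n" and \<phi>: "\<phi> \<in> gal L K"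
    have "a i (i + 1) \<phi> = m i * B (s i) i (Suc i) \<phi>" unfolding a_def P_def by simp
    then show "a i (i + 1) \<phi> mod int p = \<alpha> i \<phi> mod int p"
      using m[of i \<phi>] B1[of "s i" i \<phi>] s[of i] i \<phi> by (metis mod_mult_right_eq)
  next
    fix i j \<phi> \<tau> assume "1 \<le> i \<and> i + 1 < j \<and> j \<le> n + 1 \<and> (i, j) \<noteq> (1, n + 1)"
      and "\<phi> \<in> gal L K" "\<tau> \<in> gal L K"
    then show "(a i j \<tau> - a i j (\<phi> \<circ> \<tau>) + a i j \<phi>) mod int p = (\<Sum>l\<in>{i + 1..j - 1}. a i l \<phi> * a l j \<tau>) mod int p"
      using law by auto
  qed
  \<comment> \<open>The corner entry \<open>a 1 (n + 1)\<close>, which a defining system omits,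
    obeys the same law and is the bounding cochain.\<close>
  moreover have "coboundary2 L K p (massey_value n a)"
    unfolding coboundary2_def
  proof (intro exI[of _ "a 1 (n + 1)"] conjI ballI)
    show "cont1 L K p (a 1 (n + 1))" using cont n by auto
    fix \<phi> \<tau> assume "\<phi> \<in> gal L K" "\<tau> \<in> gal L K"
    then show "massey_value n a \<phi> \<tau> mod int p = (a 1 (n + 1) \<tau> - a 1 (n + 1) (\<phi> \<circ> \<tau>) + a 1 (n + 1) \<phi>) mod int p"
      using law[of 1 "n + 1" \<phi> \<tau>] n unfolding massey_value_def by (simp add: numeral_2_eq_2)
  qed
  ultimately show ?thesis unfolding massey_contains_zero_def by blast
qed

end

theorem theorem8p5:
  fixes L :: "('b, 'c) ring_scheme" and K :: "'b set" and p n :: nat and \<zeta> :: 'b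
    and \<alpha> :: "nat \<Rightarrow> ('b \<Rightarrow> 'b) \<Rightarrow> int"
  assumes "algebraic_closure L K"
    and "n \<ge> 3" and "prime p" and "odd p"
    and "primitive_root L K p \<zeta>"
    and "p_rigid L K p \<zeta>"
    and "\<forall>i. 1 \<le> i \<and> i \<le> n \<longrightarrow> cocycle1 L K p (\<alpha> i)"
    and "massey_defined L K p n \<alpha>"
  shows "massey_contains_zero L K p n \<alpha>"
  using algebraic_closure.massey_contains_zero_rigid[OF assms(1-6) _ assms(8)] assms(7) by blast

end
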